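(* Let $n\geq 1$ be an integer, and let $p\in(0,1)$, $q'\in(0,1)$ and $\alpha>n$ be real numbers satisfying $$\frac{1}{p}+\frac{1}{q'}-\frac{2\alpha}{q'n}=1.$$ Let $q<0$ be defined by $\frac1q+\frac1{q'}=1$. For nonnegative measurable $h$ on $\mathbb{R}^n$ set $$V_\alpha(h)(x):=\int_{\mathbb{R}^n}|x-y|^{\alpha/q'-n}\,h(y)\,|y|^{\alpha/q'}\,dy,$$ and let $$C_{n,\alpha,p,q'}:=\inf\left\{\|V_\alpha(h)\|_{L^q(\mathbb{R}^n)}:\ h\geq 0,\ \|h\|_{L^p(\mathbb{R}^n)}=1\right\}.$$ Then there exists a nonnegative function $h\in L^p(\mathbb{R}^n)$ such that $\|h\|_{L^p(\mathbb{R}^n)}=1$ and $\|V_\alpha(h)\|_{L^q(\mathbb{R}^n)}=C_{n,\alpha,p,q'}$.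
   Context: For any nonzero real exponent $t<1$ (possibly negative), $\|f\|_{L^t(\mathbb{R}^n)}:=\left(\int_{\mathbb{R}^n}|f(x)|^t\,dx\right)^{1/t}$. For negative $t$ the usual conventions $\infty^{t}=0$, $0^{t}=\infty$ are used, both pointwise and for the outer power $1/t$ (so that, for example, if $t<0$ and $f=\infty$ almost everywhere, then $\|f\|_{L^t}=\infty$). *)

theory Defs
  imports "HOL-Analysis.Analysis"
begin

text \<open>
  Real powers of extended nonnegative reals. For a negative exponent the conventions are
  \<open>0 ^ t = \<infinity>\<close> and \<open>\<infinity> ^ t = 0\<close>. These differ from those of \<open>powr\<close> on the reals, where
  \<open>0 powr t = 0\<close> for every \<open>t\<close>. The exponent \<open>0\<close> is never used below.
\<close>

definition ennpowr :: "ennreal \<Rightarrow> real \<Rightarrow> ennreal" where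
  "ennpowr x t =
     (if t = 0 then 1
      else if x = 0 then (if t < 0 then \<infinity> else 0)
      else if x = \<infinity> then (if t < 0 then 0 else \<infinity>)
      else ennreal (enn2real x powr t))"

text \<open>
  The functional \<open>(\<integral> \<bar>f\<bar> ^ t) ^ (1 / t)\<close> for nonzero real \<open>t\<close>, possibly negative; the inner
  and the outer power follow the conventions above. All functions concerned are nonnegative and
  may take the value \<open>\<infinity>\<close>, hence the type \<open>ennreal\<close> and no absolute value.
\<close>

definition Lnorm :: "real \<Rightarrow> ('a::euclidean_space \<Rightarrow> ennreal) \<Rightarrow> ennreal" where
  "Lnorm t f = ennpowr (\<integral>\<^sup>+ x. ennpowr (f x) t \<partial>lebesgue) (1 / t)"

text \<open>
  Both real powers have positive exponents when \<open>\<alpha> > n\<close> and \<open>0 < q' < 1\<close>, so \<open>0 powr _ = 0\<close>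
  is the right value on the diagonal \<open>x = y\<close> and at \<open>y = 0\<close>.
\<close>

definition V_op :: "real \<Rightarrow> real \<Rightarrow> (real ^ 'n \<Rightarrow> real) \<Rightarrow> real ^ 'n \<Rightarrow> ennreal" where
  "V_op \<alpha> q' h x =
     (\<integral>\<^sup>+ y. ennreal (norm (x - y) powr (\<alpha> / q' - real CARD('n)) * h y * norm y powr (\<alpha> / q'))
        \<partial>lebesgue)"

text \<open>
  The admissible functions: nonnegative, Lebesgue measurable, and of \<open>L^p\<close> norm one (in
  particular they belong to \<open>L^p\<close>).
\<close>

definition Lp_unit_nonneg :: "real \<Rightarrow> ('a::euclidean_space \<Rightarrow> real) set" where
  "Lp_unit_nonneg p =
     {h. h \<in> borel_measurable lebesgue \<and> (\<forall>x. 0 \<le> h x) \<and> Lnorm p (\<lambda>x. ennreal (h x)) = 1}"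

definition C_const :: "'n::finite itself \<Rightarrow> real \<Rightarrow> real \<Rightarrow> real \<Rightarrow> real \<Rightarrow> ennreal" where
  "C_const _ \<alpha> p q' q =
     Inf {Lnorm q (V_op \<alpha> q' h) | h :: real ^ 'n \<Rightarrow> real. h \<in> Lp_unit_nonneg p}"

end

(*
  Since q < 0, minimising the L^q norm of V h means maximising the integral of (V h)^q.

  Put M = integral of h(y) |y|^b. The quasi-triangle inequality for |x - y|^l gives
  M |x - x'|^l <= 2^l (V h x + V h x'), so V h grows like M |x - x0|^l away from its minimum x0, and
  dilation allows us to assume V h x0 = M. For such h a lower bound on the functional bounds M from
  above; a weighted Young inequality then bounds x0 and bounds M from below. Thus the functions
  F_k = V h_k of a maximising sequence are equicontinuous and lie between two multiples of
  (1 + |x|)^l; as l q < -n, a subsequence converges pointwise to some F and the integrals of F_k^q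
  converge to that of F^q.

  No compactness of the h_k is needed. The sets of all g with V g <= sup_{i >= k} F_i are convex and
  decrease with k, and strict concavity of g -> integral of g^p makes near-maximisers of this integral
  over them Cauchy, in the sense that their p-th powers converge in L^1. The limit h satisfies
  V h <= F by Fatou and has integral of h^p at least 1, so rescaling it gives an extremal function.
*)
theory Submission
  imports Defs "HOL-Complex_Analysis.Great_Picard"
begin

text \<open>The obstacle is p < 1. A bound on M controls h_k |y|^b only in L^1, so the h_k may
  oscillate or concentrate and need not have a pointwise convergent subsequence; and for pointwise
  limits Fatou bounds the integral of h^p from above, the wrong direction. What helps is that this
  integral is concave while V is linear: averaging keeps a constraint V g <= G and does not lower
  the integral below the mean of the two values. Since q < 0, a smaller potential is a better one,
  so an h with V h <= F is enough. The tail suprema stand in for F because h_k itself need not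
  satisfy V h_k <= F, so the set of all g with V g <= F has no evident member whose integral is at
  least 1. The relation between p, q and b says precisely that both integrals are invariant under
  one and the same dilation. This is the source of non-compactness, and it is removed by fixing V h
  x0 = M. The Young inequality compares h with the power -s of the weight |x - y|^l |y|^b, where s =
  p / (1 - p); the hypotheses on the exponents make that power integrable at both zeros of the
  weight and at infinity.\<close>

subsection \<open>Powers, radial integrals and pointwise compactness\<close>

text \<open>Either b <= e a, and then a + b <= (1 + e) a, or a < b / e. The free e matters: the
  first factor tends to 1 with e, which yields equicontinuity of the potentials, while e = 1 is the
  quasi-triangle inequality.\<close>

lemma powr_add_le_weighted:
  fixes a b e l :: real
  assumes "0 \<le> a" "0 \<le> b" "0 < e" "0 < l"
  shows "(a + b) powr l \<le> (1 + e) powr l * a powr l + (1 + 1 / e) powr l * b powr l"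
proof (cases "b \<le> e * a")
  case True
  then have "(a + b) powr l \<le> ((1 + e) * a) powr l"
    using assms by (intro powr_mono2) (auto simp: algebra_simps)
  also have "\<dots> = (1 + e) powr l * a powr l"
    using assms by (simp add: powr_mult)
  finally show ?thesis
    by (smt (verit) mult_nonneg_nonneg powr_ge_zero)
next
  case False
  then have "a \<le> b / e"
    using assms by (simp add: field_simps)
  then have "(a + b) powr l \<le> ((1 + 1 / e) * b) powr l"
    using assms by (intro powr_mono2) (auto simp: algebra_simps)
  also have "\<dots> = (1 + 1 / e) powr l * b powr l"
    using assms by (simp add: powr_mult)
  finally show ?thesis
    by (smt (verit) mult_nonneg_nonneg powr_ge_zero)
qed

lemma powr_half:
  fixes u a :: real
  assumes "0 < u"
  shows "(u / 2) powr (-a) = u powr (-a) * 2 powr a"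
  using assms powr_divide[of u 2 "-a"] by (simp add: powr_minus_divide)

lemma powr_mult_power:
  fixes u a :: real
  assumes "0 < u"
  shows "u powr (-a) * u ^ n = u powr (n - a)"
  using assms by (simp add: powr_realpow[symmetric] powr_add[symmetric])

lemma power_powr_swap:
  fixes x c :: real
  assumes "0 < x"
  shows "(x ^ k) powr c = (x powr c) ^ k"
  using assms by (simp add: powr_realpow[symmetric] powr_powr mult.commute)

lemma ennpowr_ennreal:
  assumes "0 \<le> r" "0 < t \<or> 0 < r"
  shows "ennpowr (ennreal r) t = ennreal (r powr t)"
  using assms by (auto simp: ennpowr_def)

lemma ennpowr_antimono:
  assumes "t < 0" "x \<le> y"
  shows "ennpowr y t \<le> ennpowr x t"
proof (cases "x = 0 \<or> y = \<infinity>")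
  case True
  then show ?thesis
    using assms by (auto simp: ennpowr_def)
next
  case False
  then obtain r where r: "y = ennreal r" "0 \<le> r"
    by (cases y) auto
  moreover obtain s where s: "x = ennreal s" "0 \<le> s"
    using False assms(2) by (cases x) (auto simp: top_unique)
  ultimately have "0 < s" "s \<le> r"
    using False assms(2) by (auto simp: less_le)
  then show ?thesis
    using assms(1) r s by (simp add: ennpowr_ennreal ennreal_leI powr_mono2')
qed

lemma ennpowr_eq_1_iff:
  assumes "t \<noteq> 0"
  shows "ennpowr x t = 1 \<longleftrightarrow> x = 1"
proof (cases x)
  case (real r)
  then show ?thesis
    using assms
    by (cases "r = 0") (auto simp: ennpowr_def powr_def)
next
  case top
  then show ?thesis
    using assms by (auto simp: ennpowr_def)
qed

lemma Lnorm_eq_1_iff: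
  assumes "0 < p" "\<And>x. 0 \<le> h x"
  shows "Lnorm p (\<lambda>x. ennreal (h x)) = 1 \<longleftrightarrow> (\<integral>\<^sup>+ x. ennreal (h x powr p) \<partial>lebesgue) = 1"
  using assms by (simp add: Lnorm_def ennpowr_eq_1_iff ennpowr_ennreal)

lemma nn_integral_affine_lebesgue:
  fixes f :: "'a::euclidean_space \<Rightarrow> ennreal"
  assumes f[measurable]: "f \<in> borel_measurable lebesgue" and c: "c \<noteq> 0"
  shows "(\<integral>\<^sup>+x. f x \<partial>lebesgue) = ennreal (\<bar>c\<bar> ^ DIM('a)) * (\<integral>\<^sup>+x. f (t + c *\<^sub>R x) \<partial>lebesgue)"
    and "(\<lambda>x. t + c *\<^sub>R x) \<in> lebesgue \<rightarrow>\<^sub>M lebesgue"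
proof -
  have T: "(\<lambda>x. t + (\<Sum>j\<in>Basis. (c * (x \<bullet> j)) *\<^sub>R j)) = (\<lambda>x::'a. t + c *\<^sub>R x)"
    unfolding scaleR_scaleR[symmetric] scaleR_sum_right[symmetric] euclidean_representation ..
  have eq: "lebesgue = density (distr lebesgue lebesgue (\<lambda>x::'a. t + c *\<^sub>R x)) (\<lambda>_. ennreal (\<bar>c\<bar> ^ DIM('a)))"
    using lebesgue_affine_euclidean[of "\<lambda>_::'a. c" t] c by (simp add: T)
  show m[measurable]: "(\<lambda>x. t + c *\<^sub>R x) \<in> lebesgue \<rightarrow>\<^sub>M lebesgue"
    using lebesgue_affine_measurable[of "\<lambda>_::'a. c" t] c by (simp add: T)
  have "(\<integral>\<^sup>+x. f x \<partial>lebesgue) =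
      (\<integral>\<^sup>+x. f x \<partial>density (distr lebesgue lebesgue (\<lambda>x::'a. t + c *\<^sub>R x)) (\<lambda>_. ennreal (\<bar>c\<bar> ^ DIM('a))))"
    using eq by simp
  also have "\<dots> = \<integral>\<^sup>+x. ennreal (\<bar>c\<bar> ^ DIM('a)) * f x \<partial>distr lebesgue lebesgue (\<lambda>x::'a. t + c *\<^sub>R x)"
    by (subst nn_integral_density) auto
  also have "\<dots> = ennreal (\<bar>c\<bar> ^ DIM('a)) * integral\<^sup>N (distr lebesgue lebesgue (\<lambda>x::'a. t + c *\<^sub>R x)) f"
    by (intro nn_integral_cmult) auto
  also have "\<dots> = ennreal (\<bar>c\<bar> ^ DIM('a)) * (\<integral>\<^sup>+x. f (t + c *\<^sub>R x) \<partial>lebesgue)"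
    by (subst nn_integral_distr) auto
  finally show "(\<integral>\<^sup>+x. f x \<partial>lebesgue) = ennreal (\<bar>c\<bar> ^ DIM('a)) * (\<integral>\<^sup>+x. f (t + c *\<^sub>R x) \<partial>lebesgue)" .
qed

lemma continuous_imp_lebesgue_measurable:
  fixes f :: "'a::euclidean_space \<Rightarrow> 'b::topological_space"
  assumes "continuous_on UNIV f"
  shows "f \<in> borel_measurable lebesgue"
  by (rule measurable_completion) (use borel_measurable_continuous_onI[OF assms] in simp)

section \<open>Negative powers of the distance, integrated over a ball and over its
  complement\<close>

lemma nn_integral_radial_shells_le:
  fixes z :: "'a::euclidean_space" and u v :: "nat \<Rightarrow> real"
  assumes "0 < a" and u: "\<And>k. 0 < u k" and v: "\<And>k. 0 < v k"
    and S: "\<And>y. y \<in> S \<Longrightarrow> y \<noteq> z \<Longrightarrow> \<exists>k. u k \<le> norm (y - z) \<and> norm (y - z) < v k"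
    and sums: "(\<lambda>k. u k powr (-a) * v k ^ DIM('a)) sums c"
  shows "(\<integral>\<^sup>+ y. ennreal (norm (y - z) powr (-a)) * indicator S y \<partial>lebesgue)
           \<le> ennreal (unit_ball_vol DIM('a) * c)"
proof -
  \<comment> \<open>A point of \<open>S\<close> other than \<open>z\<close> lies in a shell, where
    the integrand is at most \<open>u k powr (-a)\<close>; enlarging the shell to a ball makes its
    volume explicit. At \<open>z\<close> the integrand is 0, since
    \<open>0 powr _ = 0\<close>.\<close>
  have "ennreal (norm (y - z) powr (-a)) * indicator S y
      \<le> (\<Sum>k. ennreal (u k powr (-a)) * indicator (ball z (v k)) y)" for y
  proof (cases "y \<in> S \<and> y \<noteq> z")
    case True
    then obtain k where k: "u k \<le> norm (y - z)" "norm (y - z) < v k"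
      using S by blast
    have "ennreal (norm (y - z) powr (-a)) * indicator S y
        \<le> (\<Sum>i\<in>{k}. ennreal (u i powr (-a)) * indicator (ball z (v i)) y)"
      using True k u[of k] assms(1)
      by (auto simp: dist_norm norm_minus_commute intro!: ennreal_leI powr_mono2')
    also have "\<dots> \<le> (\<Sum>k. ennreal (u k powr (-a)) * indicator (ball z (v k)) y)"
      by (intro sum_le_suminf) auto
    finally show ?thesis .
  qed auto
  then have "(\<integral>\<^sup>+ y. ennreal (norm (y - z) powr (-a)) * indicator S y \<partial>lebesgue)
      \<le> (\<integral>\<^sup>+ y. (\<Sum>k. ennreal (u k powr (-a)) * indicator (ball z (v k)) y) \<partial>lebesgue)"
    by (intro nn_integral_mono)
  also have "\<dots> = (\<Sum>k. \<integral>\<^sup>+ y. ennreal (u k powr (-a)) * indicator (ball z (v k)) y \<partial>lebesgue)"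
    by (intro nn_integral_suminf borel_measurable_times_ennreal borel_measurable_const
        borel_measurable_indicator) simp
  also have "\<dots> = (\<Sum>k. ennreal (unit_ball_vol DIM('a) * (u k powr (-a) * v k ^ DIM('a))))"
  proof (rule suminf_cong)
    fix k
    have "(\<integral>\<^sup>+ y. ennreal (u k powr (-a)) * indicator (ball z (v k)) y \<partial>lebesgue)
        = ennreal (u k powr (-a)) * emeasure lebesgue (ball z (v k))"
      by (rule nn_integral_cmult_indicator) simp
    also have "emeasure lebesgue (ball z (v k)) = ennreal (unit_ball_vol DIM('a) * v k ^ DIM('a))"
      using v[of k] by (simp add: emeasure_ball)
    finally show "(\<integral>\<^sup>+ y. ennreal (u k powr (-a)) * indicator (ball z (v k)) y \<partial>lebesgue)
        = ennreal (unit_ball_vol DIM('a) * (u k powr (-a) * v k ^ DIM('a)))"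
      using v[of k] by (simp add: ennreal_mult'[symmetric] mult_ac)
  qed
  also have "\<dots> = ennreal (unit_ball_vol DIM('a) * c)"
    using less_imp_le[OF v]
    by (intro suminf_ennreal_eq sums_mult sums) (simp add: unit_ball_vol_nonneg)
  finally show ?thesis .
qed

text \<open>Dyadic shells shrinking to the centre: each contributes
  \<open>(1/2) powr (n - a)\<close> times the previous one, with n the dimension, so a < n makes the
  series geometric with ratio below 1. The constant is independent of radius and centre.\<close>

lemma nn_integral_radial_ball_le:
  fixes a :: real
  assumes "0 < a" "a < DIM('a)"
  obtains C where "0 \<le> C"
    "\<And>r (z::'a). 0 < r \<Longrightarrow> (\<integral>\<^sup>+ y. ennreal (norm (y - z) powr (-a)) * indicator (ball z r) y \<partial>lebesgue)
           \<le> ennreal (C * r powr (DIM('a::euclidean_space) - a))"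
proof -
  let ?n = "DIM('a)"
  define \<theta> where "\<theta> = (1/2::real) powr (?n - a)"
  have \<theta>: "0 < \<theta>" "\<theta> < 1"
    using assms powr_less_mono'[of "1/2::real" 0 "?n - a"] by (auto simp: \<theta>_def)
  define C where "C = unit_ball_vol ?n * (2 powr a * (1 / (1 - \<theta>)))"
  have bound: "(\<integral>\<^sup>+ y. ennreal (norm (y - z) powr (-a)) * indicator (ball z r) y \<partial>lebesgue)
           \<le> ennreal (C * r powr (?n - a))" if r: "0 < r" for r and z :: 'a
  proof -
    have "(\<integral>\<^sup>+ y. ennreal (norm (y - z) powr (-a)) * indicator (ball z r) y \<partial>lebesgue)
        \<le> ennreal (unit_ball_vol ?n * (r powr (?n - a) * 2 powr a * (1 / (1 - \<theta>))))"
    proof (rule nn_integral_radial_shells_le[where u="\<lambda>k. r * (1/2) ^ Suc k" and v="\<lambda>k. r * (1/2) ^ k"])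
      fix y assume y: "y \<in> ball z r" "y \<noteq> z"
      define P where "P k \<longleftrightarrow> r * (1/2) ^ Suc k \<le> norm (y - z)" for k
      have "(\<lambda>k. r * (1/2) ^ Suc k) \<longlonglongrightarrow> 0"
        by real_asymp
      moreover have "0 < norm (y - z)"
        using y by auto
      ultimately have "eventually (\<lambda>k. r * (1/2) ^ Suc k < norm (y - z)) sequentially"
        by (rule order_tendstoD(2))
      then have ex: "\<exists>k. P k"
        unfolding P_def eventually_sequentially by (meson less_imp_le order_refl)
      \<comment> \<open>Minimality supplies the outer radius of the shell; for k = 0 the outer
        radius is \<open>r\<close>, and membership in the ball supplies it.\<close>
      define k where "k = (LEAST k. P k)"
      have "P k"
        unfolding k_def using ex by (rule LeastI_ex)
      moreover have "norm (y - z) < r * (1/2) ^ k"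
      proof (cases k)
        case 0
        then show ?thesis using y by (simp add: dist_norm norm_minus_commute)
      next
        case (Suc j)
        then have "\<not> P j"
          unfolding k_def by (intro not_less_Least) auto
        then show ?thesis
          by (simp add: P_def Suc)
      qed
      ultimately show "\<exists>k. r * (1/2) ^ Suc k \<le> norm (y - z) \<and> norm (y - z) < r * (1/2) ^ k"
        unfolding P_def by blast
    next
      have "(r * (1/2) ^ Suc k) powr (-a) * (r * (1/2) ^ k) ^ ?n = r powr (?n - a) * 2 powr a * \<theta> ^ k" for k
      proof -
        let ?u = "r * (1/2) ^ k"
        have "(r * (1/2) ^ Suc k) powr (-a) = ?u powr (-a) * 2 powr a"
          using powr_half[of ?u a] r by simp
        moreover have "?u powr (-a) * ?u ^ ?n = r powr (?n - a) * \<theta> ^ k"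
          using r by (subst powr_mult_power) (simp_all add: powr_mult power_powr_swap \<theta>_def)
        ultimately show ?thesis
          by (simp add: mult_ac)
      qed
      then show "(\<lambda>k. (r * (1/2) ^ Suc k) powr (-a) * (r * (1/2) ^ k) ^ ?n) sums
          (r powr (?n - a) * 2 powr a * (1 / (1 - \<theta>)))"
        using \<theta> by (simp only:) (intro sums_mult geometric_sums, simp)
    qed (use assms r in auto)
    then show ?thesis
      by (simp add: C_def mult_ac)
  qed
  have "0 \<le> C"
    using \<theta> by (auto simp: C_def)
  then show thesis
    by (rule that) (rule bound)
qed

text \<open>The same with shells that double outwards; the ratio is now
  \<open>2 powr (n - a)\<close>, below 1 because a > n.\<close>

lemma nn_integral_radial_outside_ball_le:
  fixes a :: real
  assumes "DIM('a) < a"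
  obtains C where "0 \<le> C"
    "\<And>r (z::'a). 0 < r \<Longrightarrow> (\<integral>\<^sup>+ y. ennreal (norm (y - z) powr (-a)) * indicator (- ball z r) y \<partial>lebesgue)
           \<le> ennreal (C * r powr (DIM('a::euclidean_space) - a))"
proof -
  let ?n = "DIM('a)"
  define \<theta> where "\<theta> = (2::real) powr (?n - a)"
  have \<theta>: "0 < \<theta>" "\<theta> < 1"
    using assms powr_less_mono[of "?n - a" 0 "2::real"] by (auto simp: \<theta>_def)
  define C where "C = unit_ball_vol ?n * (2 ^ ?n * (1 / (1 - \<theta>)))"
  have bound: "(\<integral>\<^sup>+ y. ennreal (norm (y - z) powr (-a)) * indicator (- ball z r) y \<partial>lebesgue)
           \<le> ennreal (C * r powr (?n - a))" if r: "0 < r" for r and z :: 'a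
  proof -
    have "(\<integral>\<^sup>+ y. ennreal (norm (y - z) powr (-a)) * indicator (- ball z r) y \<partial>lebesgue)
        \<le> ennreal (unit_ball_vol ?n * (r powr (?n - a) * 2 ^ ?n * (1 / (1 - \<theta>))))"
    proof (rule nn_integral_radial_shells_le[where u="\<lambda>k. r * 2 ^ k" and v="\<lambda>k. r * 2 ^ Suc k"])
      fix y assume y: "y \<in> - ball z r" "y \<noteq> z"
      define P where "P k \<longleftrightarrow> norm (y - z) < r * 2 ^ Suc k" for k
      obtain m where "norm (y - z) / r < 2 ^ m"
        using real_arch_pow[of 2 "norm (y - z) / r"] by auto
      then have "P m"
        using r by (auto simp: P_def field_simps intro: less_le_trans)
      then have ex: "\<exists>k. P k" ..
      define k where "k = (LEAST k. P k)"
      have "P k"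
        unfolding k_def using ex by (rule LeastI_ex)
      moreover have "r * 2 ^ k \<le> norm (y - z)"
      proof (cases k)
        case 0
        then show ?thesis using y by (simp add: dist_norm norm_minus_commute)
      next
        case (Suc j)
        then have "\<not> P j"
          unfolding k_def by (intro not_less_Least) auto
        then show ?thesis
          by (simp add: P_def Suc)
      qed
      ultimately show "\<exists>k. r * 2 ^ k \<le> norm (y - z) \<and> norm (y - z) < r * 2 ^ Suc k"
        unfolding P_def by blast
    next
      have "(r * 2 ^ k) powr (-a) * (r * 2 ^ Suc k) ^ ?n = r powr (?n - a) * 2 ^ ?n * \<theta> ^ k" for k
      proof -
        let ?u = "r * 2 ^ k"
        have "(r * 2 ^ Suc k) ^ ?n = ?u ^ ?n * 2 ^ ?n"
          by (simp add: power_mult_distrib)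
        moreover have "?u powr (-a) * ?u ^ ?n = r powr (?n - a) * \<theta> ^ k"
          using r by (subst powr_mult_power) (simp_all add: powr_mult power_powr_swap \<theta>_def)
        ultimately show ?thesis
          by (simp add: mult_ac)
      qed
      then show "(\<lambda>k. (r * 2 ^ k) powr (-a) * (r * 2 ^ Suc k) ^ ?n) sums
          (r powr (?n - a) * 2 ^ ?n * (1 / (1 - \<theta>)))"
        using \<theta> by (simp only:) (intro sums_mult geometric_sums, simp)
    qed (use assms r in auto)
    then show ?thesis
      by (simp add: C_def mult_ac)
  qed
  have "0 \<le> C"
    using \<theta> by (auto simp: C_def)
  then show thesis
    by (rule that) (rule bound)
qed

section \<open>Quantitative strict concavity of the power p < 1\<close>

lemma powr_le_parabola:
  fixes p x :: real
  assumes p: "0 < p" "p < 1" and x: "0 \<le> x" "x \<le> 2"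
  shows "x powr p \<le> 1 + p * (x - 1) - p * (1 - p) / 18 * (x - 1)\<^sup>2"
proof (cases "x = 0")
  case True
  have "p * (1 - p) / 18 \<le> 1 * (1 - p) / 18"
    using p by (intro divide_right_mono mult_right_mono) auto
  also have "\<dots> \<le> 1 - p"
    using p by simp
  finally have "p * (1 - p) / 18 \<le> 1 - p" .
  then show ?thesis
    using True p by simp
next
  case False
  \<comment> \<open>On (0, 3) the second derivative of y^p is at most -p (1 - p) / 9 = -2 c, because
    y^(p - 2) >= 3^(-2). Hence \<open>f\<close> is convex there with f(1) = f'(1) = 0, so it is
    nonnegative. The endpoint 3 keeps x = 2 in the open interval; x = 0 lies outside it and was
    treated apart.\<close>
  define c where "c = p * (1 - p) / 18"
  define f where "f y = 1 + p * (y - 1) - c * (y - 1)\<^sup>2 - y powr p" for y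
  have "convex_on {0<..<3} f"
  proof (rule f''_ge0_imp_convex)
    fix y :: real assume y: "y \<in> {0<..<3}"
    show "(f has_real_derivative p - 2 * c * (y - 1) - p * y powr (p - 1)) (at y)"
      unfolding f_def using y by (auto intro!: derivative_eq_intros simp: field_simps)
    show "((\<lambda>y. p - 2 * c * (y - 1) - p * y powr (p - 1)) has_real_derivative
        p * (1 - p) * y powr (p - 2) - 2 * c) (at y)"
      using y by (auto intro!: derivative_eq_intros simp: algebra_simps)
    have "(1 / 9 :: real) = 3 powr (-2)"
      by (simp add: powr_minus divide_simps)
    also have "\<dots> \<le> 3 powr (p - 2)"
      using p by (intro powr_mono) auto
    also have "\<dots> \<le> y powr (p - 2)"
      using p y by (intro powr_mono2') auto
    finally have "p * (1 - p) * (1 / 9) \<le> p * (1 - p) * y powr (p - 2)"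
      using p by (intro mult_left_mono) auto
    then show "0 \<le> p * (1 - p) * y powr (p - 2) - 2 * c"
      by (simp add: c_def)
  qed simp
  then have "0 * (x - 1) \<le> f x - f 1"
  proof (rule convex_on_imp_above_tangent)
    show "(f has_real_derivative 0) (at 1 within {0<..<3})"
      unfolding f_def by (auto intro!: derivative_eq_intros)
  qed (use x False in \<open>auto simp: interior_open\<close>)
  then show ?thesis
    by (simp add: f_def c_def)
qed

text \<open>With a = m (1 + t) and b = m (1 - t) the difference is of first order in t and the
  defect of second order; 2 t <= e + t^2 / e trades one for the other. After integration, a small
  defect forces the p-th powers to be close in L^1.\<close>

lemma abs_powr_diff_le_midpoint_defect:
  fixes a b e p :: real
  assumes p: "0 < p" "p < 1" and a: "0 \<le> a" and b: "0 \<le> b" and e: "0 < e"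
  shows "\<bar>a powr p - b powr p\<bar> \<le> e * (a powr p + b powr p)
    + 18 / (p * (1 - p) * e) * (((a + b) / 2) powr p - (a powr p + b powr p) / 2)"
  using a b
proof (induction a b rule: linorder_wlog)
  case (sym b a)
  then show ?case
    by (simp add: abs_minus_commute add.commute)
next
  case (le b a)
  show ?case
  proof (cases "a = 0")
    case True
    then show ?thesis using le by simp
  next
    case False
    define m t where "m = (a + b) / 2" and "t = (a - b) / (2 * m)"
    define c where "c = p * (1 - p) / 18"
    have c: "0 < c" using p by (simp add: c_def)
    have m: "0 < m" using le False by (simp add: m_def)
    have t: "0 \<le> t" "t \<le> 1" using le m by (auto simp: t_def pos_divide_le_eq) (simp add: m_def)
    have mt: "m * t = (a - b) / 2"
      using m by (simp add: t_def)
    have ab: "a = m * (1 + t)" "b = m * (1 - t)"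
      using mt by (simp_all add: m_def distrib_left right_diff_distrib field_simps)
    let ?D = "((a + b) / 2) powr p - (a powr p + b powr p) / 2"
    have A: "a powr p = m powr p * (1 + t) powr p" "b powr p = m powr p * (1 - t) powr p"
      using m t by (simp_all add: ab powr_mult)
    have "(1 + t) powr p \<le> 1 + p * t - c * t\<^sup>2" "(1 - t) powr p \<le> 1 - p * t - c * t\<^sup>2"
      using powr_le_parabola[OF p, of "1 + t"] powr_le_parabola[OF p, of "1 - t"] t by (auto simp: c_def)
    then have "c * t\<^sup>2 \<le> 1 - ((1 + t) powr p + (1 - t) powr p) / 2"
      by argo
    then have "m powr p * (c * t\<^sup>2) \<le> m powr p * (1 - ((1 + t) powr p + (1 - t) powr p) / 2)"
      by (intro mult_left_mono) auto
    also have "\<dots> = ?D"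
      by (simp add: A m_def[symmetric] algebra_simps)
    finally have D: "m powr p * t\<^sup>2 \<le> ?D / c"
      using c by (simp add: pos_le_divide_eq mult_ac)
    have "(1 + t) powr p \<le> (1 + t) powr 1"
      using p t by (intro powr_mono) auto
    moreover have "1 - t \<le> (1 - t) powr p"
      using powr_mono'[of p 1 "1 - t"] p t by simp
    ultimately have "(1 + t) powr p - (1 - t) powr p \<le> 2 * t"
      using t by simp
    also have "2 * t \<le> e + t\<^sup>2 / e"
    proof -
      have "0 \<le> (e - t)\<^sup>2 / e"
        using e by simp
      also have "\<dots> = e + t\<^sup>2 / e - 2 * t"
        using e by (simp add: power2_eq_square field_simps)
      finally show ?thesis by simp
    qed
    finally have "m powr p * ((1 + t) powr p - (1 - t) powr p) \<le> m powr p * (e + t\<^sup>2 / e)"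
      by (intro mult_left_mono) auto
    then have "a powr p - b powr p \<le> e * m powr p + m powr p * t\<^sup>2 / e"
      by (simp add: A algebra_simps)
    also have "\<dots> \<le> e * (a powr p + b powr p) + ?D / c / e"
    proof (intro add_mono mult_left_mono divide_right_mono D)
      have "m powr p \<le> a powr p"
        using m le p by (intro powr_mono2) (auto simp: m_def)
      then show "m powr p \<le> a powr p + b powr p"
        by (simp add: add_increasing2)
    qed (use e in auto)
    also have "?D / c / e = 18 / (p * (1 - p) * e) * ?D"
      by (simp add: c_def)
    finally have "a powr p - b powr p \<le> e * (a powr p + b powr p) + 18 / (p * (1 - p) * e) * ?D" .
    moreover have "b powr p \<le> a powr p"
      using le p by (intro powr_mono2) auto
    ultimately show ?thesis
      by (simp add: abs_minus_commute add.commute)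
  qed
qed

text \<open>A diagonal argument on a countable dense set, extended to all points by equicontinuity.
  Dividing by \<open>W\<close> turns the bound into the constant 1, as the diagonal argument
  requires.\<close>

lemma pointwise_convergent_subsequence:
  fixes F :: "nat \<Rightarrow> 'a::euclidean_space \<Rightarrow> real"
  assumes W: "\<And>x. 0 < W x" and bound: "\<And>k x. \<bar>F k x\<bar> \<le> W x"
    and equi: "\<And>x d. 0 < d \<Longrightarrow> \<exists>r>0. \<forall>k x'. norm (x - x') < r \<longrightarrow> \<bar>F k x - F k x'\<bar> < d"
  obtains r where "strict_mono r" "\<And>x. convergent (\<lambda>k. F (r k) x)"
proof -
  obtain D :: "'a set" where D: "countable D" "\<And>X. open X \<Longrightarrow> X \<noteq> {} \<Longrightarrow> \<exists>d\<in>D. d \<in> X"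
    using countable_dense_setE by blast
  have "norm (F k x / W x) \<le> 1" for k x
    using W[of x] bound[of k x] by simp
  then obtain r where r: "strict_mono (r :: nat \<Rightarrow> nat)"
    "\<And>x. x \<in> D \<Longrightarrow> \<exists>l. (\<lambda>k. F (r k) x / W x) \<longlonglongrightarrow> l"
    using function_convergent_subsequence[OF D(1), of "\<lambda>k x. F k x / W x" 1] by blast
  have CD: "Cauchy (\<lambda>k. F (r k) x)" if x: "x \<in> D" for x
  proof -
    obtain l where "(\<lambda>k. F (r k) x / W x) \<longlonglongrightarrow> l"
      using r(2)[OF x] by blast
    then have "(\<lambda>k. F (r k) x / W x * W x) \<longlonglongrightarrow> l * W x"
      by (intro tendsto_mult tendsto_const)
    then have "(\<lambda>k. F (r k) x) \<longlonglongrightarrow> l * W x"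
      using W[of x] by simp
    then show ?thesis
      by (rule LIMSEQ_imp_Cauchy)
  qed
  have "Cauchy (\<lambda>k. F (r k) x)" for x
    unfolding Cauchy_def
  proof (intro allI impI)
    fix e :: real assume e: "0 < e"
    then obtain \<rho> where \<rho>: "0 < \<rho>" "\<And>k x'. norm (x - x') < \<rho> \<Longrightarrow> \<bar>F k x - F k x'\<bar> < e / 3"
      using equi[of "e / 3" x] by auto
    obtain x' where x': "x' \<in> D" "x' \<in> ball x \<rho>"
      using D(2)[of "ball x \<rho>"] \<rho>(1) by auto
    obtain M where M: "\<And>i j. M \<le> i \<Longrightarrow> M \<le> j \<Longrightarrow> dist (F (r i) x') (F (r j) x') < e / 3"
      using CD[OF x'(1)] e unfolding Cauchy_def by (meson divide_pos_pos zero_less_numeral)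
    have "dist (F (r i) x) (F (r j) x) < e" if "M \<le> i" "M \<le> j" for i j
    proof -
      have "norm (x - x') < \<rho>"
        using x'(2) by (simp add: dist_norm)
      then show ?thesis
        using M[OF that] \<rho>(2)[of x' "r i"] \<rho>(2)[of x' "r j"] unfolding dist_real_def by linarith
    qed
    then show "\<exists>M. \<forall>i\<ge>M. \<forall>j\<ge>M. dist (F (r i) x) (F (r j) x) < e"
      by blast
  qed
  then show thesis
    using r(1) by (intro that[of r]) (auto simp: Cauchy_convergent_iff)
qed

subsection \<open>The weighted potential\<close>

text \<open>
  In terms of the theorem, \<open>b = \<alpha> / q'\<close> and \<open>l = \<alpha> / q' - n\<close>; the last assumption is \<open>\<alpha> > n\<close>. The
  parameter \<open>T\<close> only fixes the type of the ambient space.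
\<close>

locale weighted_potential =
  fixes p q b l n :: real and T :: "'a::euclidean_space itself"
  assumes p: "0 < p" "p < 1" and q: "q < 0" and n_eq: "n = real DIM('a)" and l_eq: "l = b - n"
    and balance: "n / p - n / q = 2 * b" and b_gt: "n - n / q < b"
begin

definition V :: "('a \<Rightarrow> real) \<Rightarrow> 'a \<Rightarrow> ennreal" where
  "V h x = (\<integral>\<^sup>+ y. ennreal (norm (x - y) powr l * h y * norm y powr b) \<partial>lebesgue)"

definition mass :: "('a \<Rightarrow> real) \<Rightarrow> ennreal" where
  "mass h = (\<integral>\<^sup>+ y. ennreal (h y * norm y powr b) \<partial>lebesgue)"

definition A :: "('a \<Rightarrow> ennreal) \<Rightarrow> ennreal" where
  "A F = (\<integral>\<^sup>+ x. ennpowr (F x) q \<partial>lebesgue)"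

definition N :: "('a \<Rightarrow> real) \<Rightarrow> ennreal" where
  "N h = (\<integral>\<^sup>+ x. ennreal (h x powr p) \<partial>lebesgue)"

definition nonneg_meas :: "('a \<Rightarrow> real) set" where
  "nonneg_meas = {h. h \<in> borel_measurable lebesgue \<and> (\<forall>x. 0 \<le> h x)}"

lemma n_pos: "0 < n"
  by (simp add: n_eq)

lemma l_gt: "- (n / q) < l"
  using b_gt l_eq by simp

lemma l_pos: "0 < l"
proof -
  have "n / q < 0"
    using q n_pos by (simp add: divide_less_0_iff)
  then show ?thesis
    using l_gt by linarith
qed

lemma b_pos: "0 < b"
  using l_pos l_eq n_pos by simp

lemma lq_less: "l * q < - n"
  using l_gt q by (simp add: field_simps)

text \<open>The exponent for which \<open>(h w) ^ p * (w ^ (- s)) ^ (1 - p) = h ^ p\<close> for every weight \<open>w > 0\<close>.\<close>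

definition s :: real where "s = p / (1 - p)"

lemma s_pos: "0 < s"
  using p by (simp add: s_def)

text \<open>By \<open>balance\<close>, n / s = n / p - n = l + b + n / q, which lies between b and l
  + b because n / q < 0 and l > - n / q. The three inequalities are the integrability of (|z - y|^l
  |y|^b)^(-s) near 0, near z and at infinity.\<close>

lemma bs_less: "b * s < n" and ls_less: "l * s < n" and lbs_gt: "n < (l + b) * s"
proof -
  have "n / q < 0"
    using q n_pos by (simp add: divide_less_0_iff)
  have ns: "n / s = n / p - n"
    using p by (simp add: s_def field_simps)
  have "b < n / s" "n / s < l + b"
    using balance b_gt l_eq \<open>n / q < 0\<close> unfolding ns by linarith+
  then show 1: "b * s < n" and "n < (l + b) * s"
    using s_pos by (simp_all add: field_simps)
  have "l * s < b * s"
    using s_pos l_eq n_pos by simp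
  with 1 show "l * s < n" by simp
qed

lemma nonneg_measD:
  assumes "h \<in> nonneg_meas"
  shows "h \<in> borel_measurable lebesgue" "0 \<le> h x"
  using assms by (auto simp: nonneg_meas_def)

lemma measurable_norm_powr: "(\<lambda>y::'a. norm (x - y) powr c) \<in> borel_measurable lebesgue"
  "(\<lambda>y::'a. norm (y - x) powr c) \<in> borel_measurable lebesgue"
  "(\<lambda>y::'a. norm y powr c) \<in> borel_measurable lebesgue"
  by (rule measurable_completion; simp)+

lemma measurable_integrand:
  assumes "h \<in> nonneg_meas"
  shows "(\<lambda>y. ennreal (norm (x - y) powr l * h y * norm y powr b)) \<in> borel_measurable lebesgue"
    and "(\<lambda>y. ennreal (h y * norm y powr b)) \<in> borel_measurable lebesgue"
  using nonneg_measD(1)[OF assms]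
  by (auto intro!: measurable_compose[OF _ measurable_ennreal] borel_measurable_times measurable_norm_powr)

text \<open>Split at r = |z| / 2: near 0 the first factor is comparable to a power of |z|, near z
  the second one is, and elsewhere the weight behaves like |y|^(l + b). By \<open>lbs_gt\<close> the
  exponent of |z| is negative: the bound decays for large |z| and blows up at 0.\<close>

lemma weight_integral_le:
  obtains C where "0 \<le> C"
    "\<And>z::'a. z \<noteq> 0 \<Longrightarrow> (\<integral>\<^sup>+ y. ennreal ((norm (z - y) powr l * norm y powr b) powr (-s)) \<partial>lebesgue)
        \<le> ennreal (C * norm z powr (n - (l + b) * s))"
proof -
  obtain C1 where C1: "0 \<le> C1" "\<And>r z::'a. 0 < r \<Longrightarrow>
      (\<integral>\<^sup>+ y. ennreal (norm (y - z) powr (-(b * s))) * indicator (ball z r) y \<partial>lebesgue)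
           \<le> ennreal (C1 * r powr (n - b * s))"
    by (rule nn_integral_radial_ball_le[where 'a='a and a="b * s"])
      (use bs_less b_pos s_pos n_eq in auto)
  obtain C2 where C2: "0 \<le> C2" "\<And>r z::'a. 0 < r \<Longrightarrow>
      (\<integral>\<^sup>+ y. ennreal (norm (y - z) powr (-(l * s))) * indicator (ball z r) y \<partial>lebesgue)
           \<le> ennreal (C2 * r powr (n - l * s))"
    by (rule nn_integral_radial_ball_le[where 'a='a and a="l * s"])
      (use ls_less l_pos s_pos n_eq in auto)
  obtain C3 where C3: "0 \<le> C3" "\<And>r z::'a. 0 < r \<Longrightarrow>
      (\<integral>\<^sup>+ y. ennreal (norm (y - z) powr (-((l + b) * s))) * indicator (- ball z r) y \<partial>lebesgue)
           \<le> ennreal (C3 * r powr (n - (l + b) * s))"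
    by (rule nn_integral_radial_outside_ball_le[where 'a='a and a="(l + b) * s"])
      (use lbs_gt n_eq in auto)
  define C where "C = (C1 + C2 + 3 powr (l * s) * C3) * (1/2) powr (n - (l + b) * s)"
  have bound: "(\<integral>\<^sup>+ y. ennreal ((norm (z - y) powr l * norm y powr b) powr (-s)) \<partial>lebesgue)
        \<le> ennreal (C * norm z powr (n - (l + b) * s))" if "z \<noteq> 0" for z :: 'a
  proof -
    define r where "r = norm z / 2"
    have r: "0 < r"
      using that by (simp add: r_def)
    let ?f1 = "\<lambda>y::'a. ennreal (norm (y - 0) powr (-(b * s))) * indicator (ball 0 r) y"
    let ?f2 = "\<lambda>y. ennreal (norm (y - z) powr (-(l * s))) * indicator (ball z r) y"
    let ?f3 = "\<lambda>y::'a. ennreal (norm (y - 0) powr (-((l + b) * s))) * indicator (- ball 0 r) y"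
    have m: "?f1 \<in> borel_measurable lebesgue" "?f2 \<in> borel_measurable lebesgue" "?f3 \<in> borel_measurable lebesgue"
      by (intro borel_measurable_times_ennreal measurable_compose[OF _ measurable_ennreal]
          measurable_norm_powr borel_measurable_indicator; simp add: Compl_in_sets_lebesgue)+
    have le: "ennreal ((norm (z - y) powr l * norm y powr b) powr (-s))
       \<le> ennreal (r powr (-(l * s))) * ?f1 y + ennreal (r powr (-(b * s))) * ?f2 y
          + ennreal (3 powr (l * s)) * ?f3 y" for y
    proof -
      have eq: "(norm (z - y) powr l * norm y powr b) powr (-s)
          = norm (z - y) powr (-(l * s)) * norm y powr (-(b * s))"
        by (simp add: powr_mult powr_powr)
      have zr: "norm z = 2 * r" 
        by (simp add: r_def)
      have tri: "norm z \<le> norm (z - y) + norm y" "norm y \<le> norm (z - y) + norm z"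
        using norm_triangle_sub[of z y] norm_triangle_sub[of y z] by (auto simp: norm_minus_commute)
      consider "y = z" | "norm y < r" | "norm (y - z) < r" "y \<noteq> z" | "r \<le> norm y" "r \<le> norm (y - z)" by linarith
      then show ?thesis
      proof cases
        case 1
        then show ?thesis by simp
      next
        case 2
        then have "norm (z - y) powr (-(l * s)) \<le> r powr (-(l * s))"
          using r tri zr l_pos s_pos by (intro powr_mono2') auto
        then have "(norm (z - y) powr l * norm y powr b) powr (-s) \<le> r powr (-(l * s)) * norm y powr (-(b * s))"
          unfolding eq by (intro mult_right_mono) auto
        then have "ennreal ((norm (z - y) powr l * norm y powr b) powr (-s)) \<le> ennreal (r powr (-(l * s))) * ?f1 y"
          using 2 by (simp add: ennreal_mult[symmetric] ennreal_leI)
        then show ?thesis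
          by (simp add: add_increasing2)
      next
        case 3
        then have "norm y powr (-(b * s)) \<le> r powr (-(b * s))"
          using r tri zr b_pos s_pos by (intro powr_mono2') (auto simp: norm_minus_commute)
        then have "(norm (z - y) powr l * norm y powr b) powr (-s) \<le> r powr (-(b * s)) * norm (y - z) powr (-(l * s))"
          using mult_left_mono[of "norm y powr (-(b * s))" "r powr (-(b * s))" "norm (z - y) powr (-(l * s))"]
          unfolding eq by (simp add: norm_minus_commute mult.commute)
        then have "ennreal ((norm (z - y) powr l * norm y powr b) powr (-s)) \<le> ennreal (r powr (-(b * s))) * ?f2 y"
          using 3 by (simp add: ennreal_mult[symmetric] ennreal_leI dist_norm norm_minus_commute)
        then show ?thesis
          by (simp add: add_increasing2 add_increasing)
      next
        case 4
        then have y: "0 < norm y" using r by linarith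
        \<comment> \<open>Here |z| = 2 r <= 2 |z - y|, so the triangle inequality gives |y| <= 3 |z
          - y|.\<close>
        have "norm y / 3 \<le> norm (z - y)"
          using 4 tri zr by (simp add: norm_minus_commute)
        then have "norm (z - y) powr (-(l * s)) \<le> (norm y / 3) powr (-(l * s))"
          using y l_pos s_pos by (intro powr_mono2') auto
        also have "\<dots> = 3 powr (l * s) * norm y powr (-(l * s))"
          using y by (simp add: powr_divide powr_minus divide_simps)
        finally have "(norm (z - y) powr l * norm y powr b) powr (-s)
            \<le> 3 powr (l * s) * norm y powr (-(l * s)) * norm y powr (-(b * s))"
          unfolding eq by (intro mult_right_mono) auto
        also have "\<dots> = 3 powr (l * s) * norm y powr (-((l + b) * s))"
          by (simp add: powr_add[symmetric] algebra_simps)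
        finally have "ennreal ((norm (z - y) powr l * norm y powr b) powr (-s)) \<le> ennreal (3 powr (l * s)) * ?f3 y"
          using 4 by (simp add: ennreal_mult[symmetric] ennreal_leI)
        then show ?thesis
          by (simp add: add_increasing)
      qed
    qed
    have "(\<integral>\<^sup>+ y. ennreal ((norm (z - y) powr l * norm y powr b) powr (-s)) \<partial>lebesgue)
       \<le> (\<integral>\<^sup>+ y. ennreal (r powr (-(l * s))) * ?f1 y + ennreal (r powr (-(b * s))) * ?f2 y
          + ennreal (3 powr (l * s)) * ?f3 y \<partial>lebesgue)"
      by (intro nn_integral_mono le)
    also have "\<dots> = ennreal (r powr (-(l * s))) * integral\<^sup>N lebesgue ?f1 + ennreal (r powr (-(b * s))) * integral\<^sup>N lebesgue ?f2
          + ennreal (3 powr (l * s)) * integral\<^sup>N lebesgue ?f3"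
      using m by (simp add: nn_integral_add nn_integral_cmult)
    also have "\<dots> \<le> ennreal (r powr (-(l * s))) * ennreal (C1 * r powr (n - b * s))
        + ennreal (r powr (-(b * s))) * ennreal (C2 * r powr (n - l * s))
        + ennreal (3 powr (l * s)) * ennreal (C3 * r powr (n - (l + b) * s))"
      using r by (intro add_mono mult_left_mono C1 C2 C3) auto
    also have "\<dots> = ennreal (r powr (-(l * s)) * (C1 * r powr (n - b * s))
        + r powr (-(b * s)) * (C2 * r powr (n - l * s)) + 3 powr (l * s) * (C3 * r powr (n - (l + b) * s)))"
      using C1(1) C2(1) C3(1) by (simp add: ennreal_mult ennreal_plus)
    also have "r powr (-(l * s)) * (C1 * r powr (n - b * s))
        + r powr (-(b * s)) * (C2 * r powr (n - l * s)) + 3 powr (l * s) * (C3 * r powr (n - (l + b) * s))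
        = (C1 + C2 + 3 powr (l * s) * C3) * r powr (n - (l + b) * s)"
    proof -
      have "r powr (-(l * s)) * r powr (n - b * s) = r powr (n - (l + b) * s)"
        "r powr (-(b * s)) * r powr (n - l * s) = r powr (n - (l + b) * s)"
        by (simp_all add: powr_add[symmetric] algebra_simps)
      then show ?thesis
        by (simp add: distrib_right mult.left_commute[of _ C1] mult.left_commute[of _ C2] mult.assoc)
    qed
    also have "\<dots> = C * norm z powr (n - (l + b) * s)"
      by (simp add: C_def r_def powr_divide)
    finally show ?thesis .
  qed
  have "0 \<le> C"
    using C1(1) C2(1) C3(1) by (simp add: C_def)
  then show thesis
    by (rule that) (rule bound)
qed

text \<open>Writing w for the weight, Young is applied to h^p = t^p (h w / t)^p (w^(-s))^(1 - p). A
  large t makes the coefficient of \<open>V h x\<close> small, a small t that of the weight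
  integral; both choices are used.\<close>

lemma N_le_Young:
  assumes h: "h \<in> nonneg_meas" and t: "0 < t"
  shows "N h \<le> ennreal (p * t powr (p - 1)) * V h x
     + ennreal ((1 - p) * t powr p) * (\<integral>\<^sup>+ y. ennreal ((norm (x - y) powr l * norm y powr b) powr (-s)) \<partial>lebesgue)"
proof -
  let ?w = "\<lambda>y. norm (x - y) powr l * norm y powr b"
  \<comment> \<open>At y = x and y = 0 the weight vanishes and \<open>powr\<close> gives w^(-s) = 0,
    so the pointwise inequality can fail there.\<close>
  have "AE y in lebesgue. y \<noteq> x \<and> y \<noteq> (0::'a)"
    using AE_conjI[OF AE_lborel_singleton[of x] AE_lborel_singleton[of 0]] by (rule AE_completion)
  moreover have "ennreal (h y powr p) \<le> ennreal (p * t powr (p - 1)) * ennreal (norm (x - y) powr l * h y * norm y powr b)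
      + ennreal ((1 - p) * t powr p) * ennreal (?w y powr (-s))" if y: "y \<noteq> x \<and> y \<noteq> 0" for y
  proof (cases "h y = 0")
    case False
    have w: "0 < ?w y" using y by auto
    have h0: "0 < h y" using False nonneg_measD(2)[OF h, of y] by simp
    have "(h y * ?w y / t) powr p * (?w y powr (-s)) powr (1 - p) \<le> p * (h y * ?w y / t) + (1 - p) * ?w y powr (-s)"
      using p h0 w t by (intro Youngs_inequality_0) auto
    moreover have "(?w y powr (-s)) powr (1 - p) = ?w y powr (-p)"
      using p by (simp add: powr_powr s_def)
    moreover have "(h y * ?w y / t) powr p = h y powr p * ?w y powr p / t powr p"
      using h0 w t by (simp add: powr_divide powr_mult)
    ultimately have "h y powr p * (?w y powr p * ?w y powr (-p)) / t powr p \<le> p * (h y * ?w y / t) + (1 - p) * ?w y powr (-s)"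
      by (simp add: mult_ac)
    also have "?w y powr p * ?w y powr (-p) = 1"
      using less_imp_neq[OF w] by (simp add: powr_add[symmetric])
    finally have "h y powr p \<le> (p * (h y * ?w y / t) + (1 - p) * ?w y powr (-s)) * t powr p"
      using t by (simp add: pos_divide_le_eq)
    also have "\<dots> = p * t powr (p - 1) * (norm (x - y) powr l * h y * norm y powr b) + (1 - p) * t powr p * ?w y powr (-s)"
      using t by (simp add: powr_diff algebra_simps)
    finally show ?thesis
      using p h0 by (simp add: ennreal_mult[symmetric] ennreal_plus[symmetric] ennreal_leI del: ennreal_plus)
  qed simp
  ultimately have "AE y in lebesgue. ennreal (h y powr p) \<le> ennreal (p * t powr (p - 1)) * ennreal (norm (x - y) powr l * h y * norm y powr b)
      + ennreal ((1 - p) * t powr p) * ennreal (?w y powr (-s))"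
    by (rule eventually_mono)
  then have "N h \<le> (\<integral>\<^sup>+ y. ennreal (p * t powr (p - 1)) * ennreal (norm (x - y) powr l * h y * norm y powr b)
      + ennreal ((1 - p) * t powr p) * ennreal (?w y powr (-s)) \<partial>lebesgue)"
    unfolding N_def by (rule nn_integral_mono_AE)
  also have "\<dots> = ennreal (p * t powr (p - 1)) * V h x
     + ennreal ((1 - p) * t powr p) * (\<integral>\<^sup>+ y. ennreal (?w y powr (-s)) \<partial>lebesgue)"
  proof -
    have "(\<lambda>y. ennreal (?w y powr (-s))) \<in> borel_measurable lebesgue"
      by (rule measurable_completion) simp
    then show ?thesis
      using measurable_integrand(1)[OF h] unfolding V_def
      by (subst nn_integral_add) (auto simp: nn_integral_cmult)
  qed
  finally show ?thesis .
qed

lemma V_le_V: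
  assumes h: "h \<in> nonneg_meas" and e: "0 < e"
  shows "V h x \<le> ennreal ((1 + e) powr l) * V h x' + ennreal ((1 + 1 / e) powr l * norm (x - x') powr l) * mass h"
proof -
  have "ennreal (norm (x - y) powr l * h y * norm y powr b)
     \<le> ennreal ((1 + e) powr l) * ennreal (norm (x' - y) powr l * h y * norm y powr b)
        + ennreal ((1 + 1 / e) powr l * norm (x - x') powr l) * ennreal (h y * norm y powr b)" for y
  proof -
    have "norm (x - y) powr l \<le> (norm (x' - y) + norm (x - x')) powr l"
      using l_pos norm_triangle_ineq[of "x' - y" "x - x'"] by (intro powr_mono2) auto
    also have "\<dots> \<le> (1 + e) powr l * norm (x' - y) powr l + (1 + 1 / e) powr l * norm (x - x') powr l"
      using e l_pos by (intro powr_add_le_weighted) auto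
    finally have "norm (x - y) powr l * (h y * norm y powr b)
       \<le> ((1 + e) powr l * norm (x' - y) powr l + (1 + 1 / e) powr l * norm (x - x') powr l) * (h y * norm y powr b)"
      using nonneg_measD(2)[OF h, of y] by (intro mult_right_mono) auto
    then show ?thesis
      using nonneg_measD(2)[OF h, of y]
      by (simp add: ennreal_mult[symmetric] ennreal_plus[symmetric] ennreal_leI algebra_simps del: ennreal_plus)
  qed
  then have "V h x \<le> (\<integral>\<^sup>+ y. ennreal ((1 + e) powr l) * ennreal (norm (x' - y) powr l * h y * norm y powr b)
        + ennreal ((1 + 1 / e) powr l * norm (x - x') powr l) * ennreal (h y * norm y powr b) \<partial>lebesgue)"
    unfolding V_def by (rule nn_integral_mono)
  also have "\<dots> = ennreal ((1 + e) powr l) * V h x' + ennreal ((1 + 1 / e) powr l * norm (x - x') powr l) * mass h"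
    using measurable_integrand[OF h] unfolding V_def mass_def
    by (subst nn_integral_add) (auto simp: nn_integral_cmult)
  finally show ?thesis .
qed

lemma mass_le_V:
  assumes h: "h \<in> nonneg_meas"
  shows "ennreal (norm (x - x') powr l) * mass h \<le> ennreal (2 powr l) * (V h x + V h x')"
proof -
  have "ennreal (norm (x - x') powr l) * ennreal (h y * norm y powr b)
     \<le> ennreal (2 powr l) * ennreal (norm (x - y) powr l * h y * norm y powr b)
        + ennreal (2 powr l) * ennreal (norm (x' - y) powr l * h y * norm y powr b)" for y
  proof -
    have "norm (x - x') powr l \<le> (norm (x - y) + norm (x' - y)) powr l"
      using l_pos norm_triangle_ineq4[of "x - y" "x' - y"] by (intro powr_mono2) auto
    also have "\<dots> \<le> 2 powr l * norm (x - y) powr l + 2 powr l * norm (x' - y) powr l"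
      using l_pos powr_add_le_weighted[of "norm (x - y)" "norm (x' - y)" 1 l] by simp
    finally have "norm (x - x') powr l * (h y * norm y powr b)
       \<le> (2 powr l * norm (x - y) powr l + 2 powr l * norm (x' - y) powr l) * (h y * norm y powr b)"
      using nonneg_measD(2)[OF h, of y] by (intro mult_right_mono) auto
    then show ?thesis
      using nonneg_measD(2)[OF h, of y]
      by (simp add: ennreal_mult[symmetric] ennreal_plus[symmetric] ennreal_leI algebra_simps del: ennreal_plus)
  qed
  then have "(\<integral>\<^sup>+ y. ennreal (norm (x - x') powr l) * ennreal (h y * norm y powr b) \<partial>lebesgue)
     \<le> (\<integral>\<^sup>+ y. ennreal (2 powr l) * ennreal (norm (x - y) powr l * h y * norm y powr b)
        + ennreal (2 powr l) * ennreal (norm (x' - y) powr l * h y * norm y powr b) \<partial>lebesgue)"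
    by (rule nn_integral_mono)
  then show ?thesis
    using measurable_integrand[OF h] unfolding V_def mass_def
    by (subst (asm) nn_integral_add) (auto simp: nn_integral_cmult distrib_left)
qed

subsection \<open>Regularity and normalisation by dilation\<close>

text \<open>
  The two inequalities that \<open>V h\<close> inherits from its kernel, with \<open>M\<close> in the role of \<open>mass h\<close>.
\<close>

definition regular :: "real \<Rightarrow> ('a \<Rightarrow> real) \<Rightarrow> bool" where
  "regular M F \<longleftrightarrow> 0 \<le> M \<and> (\<forall>x. 0 \<le> F x) \<and>
     (\<forall>x x' e. 0 < e \<longrightarrow> F x \<le> (1 + e) powr l * F x' + (1 + 1 / e) powr l * norm (x - x') powr l * M) \<and>
     (\<forall>x x'. norm (x - x') powr l * M \<le> 2 powr l * (F x + F x'))"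

lemma regularD:
  assumes "regular M F"
  shows "0 \<le> M" "0 \<le> F x"
    "0 < e \<Longrightarrow> F x \<le> (1 + e) powr l * F x' + (1 + 1 / e) powr l * norm (x - x') powr l * M"
    "norm (x - x') powr l * M \<le> 2 powr l * (F x + F x')"
  using assms unfolding regular_def by auto

lemma regular_le:
  assumes "regular M F"
  shows "F x \<le> 2 powr l * (F x' + norm (x - x') powr l * M)"
  using regularD(3)[OF assms, of 1 x x'] by (simp add: algebra_simps)

lemma regular_V:
  assumes h: "h \<in> nonneg_meas" and M: "0 \<le> M" "mass h = ennreal M"
    and v: "\<And>x. 0 \<le> v x" "\<And>x. V h x = ennreal (v x)"
  shows "regular M v"
proof -
  have "v x \<le> (1 + e) powr l * v x' + (1 + 1 / e) powr l * norm (x - x') powr l * M" if "0 < e" for x x' e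
    using V_le_V[OF h that, of x x'] M v
    by (simp add: ennreal_mult[symmetric] ennreal_plus[symmetric] del: ennreal_plus)
  moreover have "norm (x - x') powr l * M \<le> 2 powr l * (v x + v x')" for x x'
    using mass_le_V[OF h, of x x'] M v
    by (simp add: ennreal_mult[symmetric] ennreal_plus[symmetric] del: ennreal_plus)
  ultimately show ?thesis
    using M v by (simp add: regular_def)
qed

text \<open>The radius depends only on \<open>B\<close>, \<open>M0\<close> and \<open>d\<close>, so
  a single one serves every member of a family with common bounds.\<close>

lemma regular_equicontinuous:
  assumes B: "0 \<le> B" and M0: "0 \<le> M0" and d: "0 < d"
  obtains r where "0 < r"
    "\<And>M F x x'. regular M F \<Longrightarrow> M \<le> M0 \<Longrightarrow> F x \<le> B \<Longrightarrow> norm (x - x') < r \<Longrightarrow> \<bar>F x - F x'\<bar> < d"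
proof -
  \<comment> \<open>Bounds \<open>F x'\<close> for every \<open>x'\<close> within distance 1 of
    \<open>x\<close>; hence the demand r < 1 below.\<close>
  define B' where "B' = 2 powr l * (B + M0)"
  have B': "0 \<le> B'" using B M0 by (simp add: B'_def)
  have "((\<lambda>e. ((1 + e) powr l - 1) * (B + B')) \<longlongrightarrow> ((1 + 0) powr l - 1) * (B + B')) (at_right 0)"
    by (intro tendsto_intros) auto
  then have "eventually (\<lambda>e. ((1 + e) powr l - 1) * (B + B') < d / 2) (at_right (0::real))"
    using d by (intro order_tendstoD(2)) auto
  then obtain e where e: "0 < e" "((1 + e) powr l - 1) * (B + B') < d / 2"
    using eventually_happens[OF eventually_conj[OF _ eventually_at_right_less[of "0::real"]]] by force
  \<comment> \<open>This factor blows up as e tends to 0, so e is fixed first and the radius is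
    chosen afterwards.\<close>
  define c where "c = (1 + 1 / e) powr l"
  have c: "0 \<le> c" by (simp add: c_def)
  have "((\<lambda>r. c * r powr l * M0) \<longlongrightarrow> c * 0 powr l * M0) (at_right 0)"
    using l_pos by (intro tendsto_intros) (auto simp: eventually_at_right_less intro!: eventually_at_rightI[of 0 1])
  then have "eventually (\<lambda>r. c * r powr l * M0 < d / 2) (at_right (0::real))"
    using d by (intro order_tendstoD(2)) auto
  moreover have "eventually (\<lambda>r::real. r < 1) (at_right 0)"
    by (rule eventually_at_rightI[of 0 1]) auto
  ultimately have "eventually (\<lambda>r. c * r powr l * M0 < d / 2 \<and> r < 1 \<and> 0 < r) (at_right (0::real))"
    using eventually_at_right_less[of "0::real"] by eventually_elim auto
  then obtain r where r: "0 < r" "r < 1" "c * r powr l * M0 < d / 2"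
    using eventually_happens by force
  show thesis
  proof (rule that[OF r(1)])
    fix M F and x x' :: 'a
    assume F: "regular M F" and M: "M \<le> M0" and FB: "F x \<le> B" and x: "norm (x - x') < r"
    have pw: "norm (x - x') powr l \<le> r powr l" "norm (x - x') powr l \<le> 1"
      using x r l_pos by (auto intro!: powr_mono2 powr_le1)
    have "F x' \<le> 2 powr l * (F x + norm (x' - x) powr l * M)"
      by (rule regular_le[OF F])
    also have "\<dots> \<le> B'"
      unfolding B'_def using pw(2) FB M regularD(1)[OF F] M0
      by (intro mult_left_mono add_mono) (auto simp: norm_minus_commute intro: order_trans[OF mult_mono[of _ 1 _ M0]])
    finally have FB': "F x' \<le> B'" .
    have "c * norm (x - x') powr l * M \<le> c * r powr l * M0"
      using pw c M regularD(1)[OF F] by (intro mult_mono) auto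
    then have c2: "c * norm (x - x') powr l * M < d / 2"
      using r by linarith
    have g0: "0 \<le> (1 + e) powr l - 1"
      using e l_pos by (simp add: ge_one_powr_ge_zero)
    have "((1 + e) powr l - 1) * F x \<le> ((1 + e) powr l - 1) * (B + B')"
      "((1 + e) powr l - 1) * F x' \<le> ((1 + e) powr l - 1) * (B + B')"
      using FB FB' B B' g0 by (auto intro!: mult_left_mono)
    moreover have "F x \<le> (1 + e) powr l * F x' + c * norm (x - x') powr l * M"
      "F x' \<le> (1 + e) powr l * F x + c * norm (x - x') powr l * M"
      using regularD(3)[OF F e(1), of x x'] regularD(3)[OF F e(1), of x' x]
      by (auto simp: c_def norm_minus_commute)
    ultimately show "\<bar>F x - F x'\<bar> < d"
      using c2 e(2) by (auto simp: abs_less_iff left_diff_distrib)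
  qed
qed

lemma regular_continuous:
  assumes F: "regular M F"
  shows "continuous_on UNIV F"
  unfolding continuous_on_iff
proof (intro ballI allI impI)
  fix x :: 'a and d :: real
  assume "0 < d"
  then obtain r where r: "0 < r"
    "\<And>M' F' y y'. regular M' F' \<Longrightarrow> M' \<le> M \<Longrightarrow> F' y \<le> F x \<Longrightarrow> norm (y - y') < r \<Longrightarrow> \<bar>F' y - F' y'\<bar> < d"
    using regular_equicontinuous[OF regularD(2)[OF F] regularD(1)[OF F], of d x] by blast
  then show "\<exists>r>0. \<forall>x'\<in>UNIV. dist x' x < r \<longrightarrow> dist (F x') (F x) < d"
    using r(2)[OF F, of x] by (intro exI[of _ r]) (simp add: dist_norm norm_minus_commute abs_minus_commute)
qed

lemma regular_attains_inf:
  assumes F: "regular M F" and M: "0 < M"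
  obtains x0 where "\<And>x. F x0 \<le> F x"
proof -
  \<comment> \<open>For |x| >= R the growth inequality between x and 0 reads 2 F 0 <= F x + F 0, so
    no value outside the ball is below \<open>F 0\<close>.\<close>
  define R where "R = (2 powr l * (2 * F 0) / M) powr (1 / l)"
  have "continuous_on (cball 0 R) F"
    using regular_continuous[OF F] continuous_on_subset by blast
  moreover have "compact (cball 0 R :: 'a set)" "cball 0 R \<noteq> ({} :: 'a set)"
    by (auto simp: R_def)
  ultimately obtain x0 where x0: "x0 \<in> cball 0 R" "\<And>x. x \<in> cball 0 R \<Longrightarrow> F x0 \<le> F x"
    using continuous_attains_inf[of "cball 0 R" F] by blast
  have "F x0 \<le> F x" for x
  proof (cases "norm x \<le> R")
    case False
    have "R powr l = 2 powr l * (2 * F 0) / M"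
      using M regularD(2)[OF F, of 0] l_pos by (simp add: R_def powr_powr)
    moreover have "R powr l \<le> norm x powr l"
      using False l_pos by (intro powr_mono2) (auto simp: R_def)
    ultimately have "2 powr l * (2 * F 0) \<le> norm x powr l * M"
      using M by (simp add: pos_divide_le_eq)
    also have "\<dots> \<le> 2 powr l * (F x + F 0)"
      using regularD(4)[OF F, of x 0] by simp
    finally have "F 0 \<le> F x"
      by simp
    then show ?thesis
      using x0(2)[of 0] by (auto simp: R_def)
  qed (use x0 in auto)
  then show thesis
    by (rule that)
qed

lemma AE_lebesgue_not_eq: "AE x in lebesgue. x \<noteq> (c::'a)"
  using AE_lborel_singleton[of c] by (rule AE_completion)

lemma V_finite:
  assumes h: "h \<in> nonneg_meas" and A: "A (V h) \<noteq> 0"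
  shows "mass h < \<infinity>" "V h x < \<infinity>"
proof -
  \<comment> \<open>A potential infinite off a single point has q-th power 0 almost everywhere. Two
    finite values at distinct points bound the mass, and the mass together with one finite value
    bounds every other value.\<close>
  have "\<exists>x1 x2. x1 \<noteq> x2 \<and> V h x1 < \<infinity> \<and> V h x2 < \<infinity>"
  proof (rule ccontr)
    assume "\<not> ?thesis"
    then obtain x1 where "\<And>x. x \<noteq> x1 \<Longrightarrow> V h x = \<infinity>"
      by (metis top.not_eq_extremum infinity_ennreal_def)
    then have "AE x in lebesgue. ennpowr (V h x) q = 0"
      using AE_lebesgue_not_eq[of x1] q by (auto simp: ennpowr_def elim!: eventually_mono)
    then have "A (V h) = (\<integral>\<^sup>+ x. 0 \<partial>(lebesgue :: 'a measure))"
      unfolding A_def by (intro nn_integral_cong_AE)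
    then show False
      using A by simp
  qed
  then obtain x1 x2 where x: "x1 \<noteq> x2" "V h x1 < \<infinity>" "V h x2 < \<infinity>" by blast
  have "ennreal (norm (x1 - x2) powr l) * mass h < \<infinity>"
    using mass_le_V[OF h, of x1 x2] by (rule le_less_trans) (use x in \<open>simp add: ennreal_mult_less_top\<close>)
  then show M: "mass h < \<infinity>"
    using x(1) by (auto simp: ennreal_mult_less_top)
  show "V h x < \<infinity>"
    by (rule le_less_trans[OF V_le_V[OF h, of 1 x x1]])
      (use x M in \<open>auto simp: ennreal_mult_less_top\<close>)
qed

lemma N_eq_0:
  assumes h: "h \<in> nonneg_meas" and 0: "V h x = 0 \<or> mass h = 0"
  shows "N h = 0"
proof -
  have "AE y in lebesgue. y \<noteq> x \<and> y \<noteq> 0"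
    using AE_lebesgue_not_eq by (intro AE_conjI)
  moreover have "(AE y in lebesgue. ennreal (norm (x - y) powr l * h y * norm y powr b) = 0) \<or>
      (AE y in lebesgue. ennreal (h y * norm y powr b) = 0)"
    using 0 measurable_integrand[OF h] unfolding V_def mass_def by (auto simp: nn_integral_0_iff_AE)
  ultimately have "AE y in lebesgue. ennreal (h y powr p) = 0"
  proof (elim disjE)
    assume "AE y in lebesgue. ennreal (norm (x - y) powr l * h y * norm y powr b) = 0"
      and "AE y in lebesgue. y \<noteq> x \<and> y \<noteq> 0"
    then show ?thesis
    proof eventually_elim
      case (elim y)
      then show ?case
        using nonneg_measD(2)[OF h, of y] by (auto simp: ennreal_eq_0_iff mult_le_0_iff)
    qed
  next
    assume "AE y in lebesgue. ennreal (h y * norm y powr b) = 0"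
      and "AE y in lebesgue. y \<noteq> x \<and> y \<noteq> 0"
    then show ?thesis
    proof eventually_elim
      case (elim y)
      then show ?case
        using nonneg_measD(2)[OF h, of y] by (auto simp: ennreal_eq_0_iff mult_le_0_iff)
    qed
  qed
  then show ?thesis
    unfolding N_def by (subst nn_integral_cong_AE[where v="\<lambda>_. 0"]) auto
qed

section \<open>Dilations, their invariants and the normalisation\<close>

definition dilate :: "real \<Rightarrow> ('a \<Rightarrow> real) \<Rightarrow> 'a \<Rightarrow> real" where
  "dilate d h y = d powr (n / p) * h (d *\<^sub>R y)"

lemma nn_integral_dilate:
  fixes f :: "'a \<Rightarrow> ennreal"
  assumes "f \<in> borel_measurable lebesgue" "0 < d"
  shows "(\<integral>\<^sup>+ x. f (d *\<^sub>R x) \<partial>lebesgue) = ennreal (d powr (-n)) * (\<integral>\<^sup>+ x. f x \<partial>lebesgue)"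
proof -
  have "(\<integral>\<^sup>+ x. f x \<partial>lebesgue) = ennreal (d powr n) * (\<integral>\<^sup>+ x. f (d *\<^sub>R x) \<partial>lebesgue)"
    using nn_integral_affine_lebesgue(1)[OF assms(1), of d 0] assms(2)
    by (simp add: n_eq powr_realpow)
  moreover have "ennreal (d powr (-n)) * ennreal (d powr n) = 1"
    using assms(2) by (simp add: ennreal_mult[symmetric] powr_add[symmetric])
  ultimately show ?thesis
    by (simp add: mult.assoc[symmetric])
qed

lemma measurable_dilate:
  fixes f :: "'a \<Rightarrow> 'b::topological_space"
  assumes "f \<in> borel_measurable lebesgue" "0 < d"
  shows "(\<lambda>x. f (d *\<^sub>R x)) \<in> borel_measurable lebesgue"
  using measurable_compose[OF nn_integral_affine_lebesgue(2)[of "\<lambda>_. 0" d 0] assms(1)] assms(2)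
  by simp

lemma dilate_nonneg_meas:
  assumes h: "h \<in> nonneg_meas" and d: "0 < d"
  shows "dilate d h \<in> nonneg_meas"
proof -
  have "(\<lambda>y. h (d *\<^sub>R y)) \<in> borel_measurable lebesgue"
    by (rule measurable_dilate[OF nonneg_measD(1)[OF h] d])
  then show ?thesis
    using nonneg_measD(2)[OF h] by (simp add: nonneg_meas_def dilate_def[abs_def])
qed

lemma N_dilate:
  assumes h: "h \<in> nonneg_meas" and d: "0 < d"
  shows "N (dilate d h) = N h"
proof -
  have m: "(\<lambda>x. ennreal (h x powr p)) \<in> borel_measurable lebesgue"
    using nonneg_measD(1)[OF h] by simp
  have m': "(\<lambda>x. ennreal (h (d *\<^sub>R x) powr p)) \<in> borel_measurable lebesgue"
    by (rule measurable_dilate[OF m d])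
  have "N (dilate d h) = (\<integral>\<^sup>+ x. ennreal (d powr n) * ennreal (h (d *\<^sub>R x) powr p) \<partial>lebesgue)"
    unfolding N_def dilate_def using p d nonneg_measD(2)[OF h]
    by (intro nn_integral_cong) (simp add: powr_mult powr_powr ennreal_mult)
  also have "\<dots> = ennreal (d powr n) * (ennreal (d powr (-n)) * N h)"
    using nn_integral_dilate[OF m d] m' by (simp add: nn_integral_cmult N_def)
  also have "\<dots> = N h"
    using d by (simp add: mult.assoc[symmetric] ennreal_mult[symmetric] powr_add[symmetric])
  finally show ?thesis .
qed

text \<open>Kernel, weight and Jacobian contribute the exponent n / p - l - b - n = n / p - 2 b,
  which is n / q by \<open>balance\<close>.\<close>

lemma V_dilate:
  assumes h: "h \<in> nonneg_meas" and d: "0 < d"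
  shows "V (dilate d h) x = ennreal (d powr (n / q)) * V h (d *\<^sub>R x)"
proof -
  let ?f = "\<lambda>y. ennreal (norm (d *\<^sub>R x - y) powr l * h y * norm y powr b)"
  have m: "(\<lambda>y. ?f (d *\<^sub>R y)) \<in> borel_measurable lebesgue"
    by (rule measurable_dilate[OF measurable_integrand(1)[OF h] d])
  have "V (dilate d h) x = (\<integral>\<^sup>+ y. ennreal (d powr (n / p - l - b)) * ?f (d *\<^sub>R y) \<partial>lebesgue)"
    unfolding V_def dilate_def
  proof (intro nn_integral_cong)
    fix y
    have "norm (d *\<^sub>R x - d *\<^sub>R y) = d * norm (x - y)"
      using d by (simp add: scaleR_diff_right[symmetric])
    moreover have "d powr (n / p - l - b) * d powr l * d powr b = d powr (n / p)"
      using d by (simp add: powr_add[symmetric])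
    ultimately have "d powr (n / p - l - b) * (norm (d *\<^sub>R x - d *\<^sub>R y) powr l * h (d *\<^sub>R y) * norm (d *\<^sub>R y) powr b)
        = norm (x - y) powr l * (d powr (n / p) * h (d *\<^sub>R y)) * norm y powr b"
      using d by (simp add: powr_mult mult_ac)
    then show "ennreal (norm (x - y) powr l * (d powr (n / p) * h (d *\<^sub>R y)) * norm y powr b)
        = ennreal (d powr (n / p - l - b)) * ?f (d *\<^sub>R y)"
      by (metis ennreal_mult' powr_ge_zero)
  qed
  also have "\<dots> = ennreal (d powr (n / p - l - b)) * (ennreal (d powr (-n)) * V h (d *\<^sub>R x))"
    using nn_integral_dilate[OF measurable_integrand(1)[OF h] d] m
    unfolding V_def by (simp add: nn_integral_cmult)
  also have "\<dots> = ennreal (d powr (n / p - l - b) * d powr (-n)) * V h (d *\<^sub>R x)"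
    by (simp add: mult.assoc ennreal_mult)
  also have "d powr (n / p - l - b) * d powr (-n) = d powr (n / q)"
    using balance l_eq by (simp add: powr_add[symmetric]) (simp add: algebra_simps)
  finally show ?thesis .
qed

text \<open>Compared with the potential, the mass picks up the additional factor
  \<open>d powr l\<close>; this lets a dilation adjust the ratio of the two.\<close>

lemma mass_dilate:
  assumes h: "h \<in> nonneg_meas" and d: "0 < d"
  shows "mass (dilate d h) = ennreal (d powr (n / q + l)) * mass h"
proof -
  let ?f = "\<lambda>y. ennreal (h y * norm y powr b)"
  have m: "(\<lambda>y. ?f (d *\<^sub>R y)) \<in> borel_measurable lebesgue"
    by (rule measurable_dilate[OF measurable_integrand(2)[OF h] d])
  have "mass (dilate d h) = (\<integral>\<^sup>+ y. ennreal (d powr (n / p - b)) * ?f (d *\<^sub>R y) \<partial>lebesgue)"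
    unfolding mass_def dilate_def
  proof (intro nn_integral_cong)
    fix y
    have "d powr (n / p - b) * d powr b = d powr (n / p)"
      using d by (simp add: powr_add[symmetric])
    then have "d powr (n / p - b) * (h (d *\<^sub>R y) * norm (d *\<^sub>R y) powr b)
        = (d powr (n / p) * h (d *\<^sub>R y)) * norm y powr b"
      using d by (simp add: powr_mult mult_ac)
    then show "ennreal ((d powr (n / p) * h (d *\<^sub>R y)) * norm y powr b)
        = ennreal (d powr (n / p - b)) * ?f (d *\<^sub>R y)"
      by (metis ennreal_mult' powr_ge_zero)
  qed
  also have "\<dots> = ennreal (d powr (n / p - b)) * (ennreal (d powr (-n)) * mass h)"
    using nn_integral_dilate[OF measurable_integrand(2)[OF h] d] m
    unfolding mass_def by (simp add: nn_integral_cmult)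
  also have "\<dots> = ennreal (d powr (n / p - b) * d powr (-n)) * mass h"
    by (simp add: mult.assoc ennreal_mult)
  also have "d powr (n / p - b) * d powr (-n) = d powr (n / q + l)"
    using balance l_eq by (simp add: powr_add[symmetric]) (simp add: algebra_simps)
  finally show ?thesis .
qed

text \<open>The q-th power of the factor \<open>d powr (n / q)\<close> is \<open>d powr n\<close>,
  which cancels the Jacobian.\<close>

lemma A_V_dilate:
  assumes h: "h \<in> nonneg_meas" and d: "0 < d"
    and v: "continuous_on UNIV v" "\<And>x. 0 < v x" "\<And>x. V h x = ennreal (v x)"
  shows "A (V (dilate d h)) = A (V h)"
proof -
  have m: "(\<lambda>x. ennreal (v x powr q)) \<in> borel_measurable lebesgue"
    using continuous_imp_lebesgue_measurable[OF v(1)] by simp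
  have m': "(\<lambda>x. ennreal (v (d *\<^sub>R x) powr q)) \<in> borel_measurable lebesgue"
    by (rule measurable_dilate[OF m d])
  have AV: "A (V h) = (\<integral>\<^sup>+ x. ennreal (v x powr q) \<partial>lebesgue)"
    unfolding A_def using v by (simp add: ennpowr_ennreal less_imp_le)
  have "A (V (dilate d h)) = (\<integral>\<^sup>+ x. ennreal (d powr n) * ennreal (v (d *\<^sub>R x) powr q) \<partial>lebesgue)"
    unfolding A_def
  proof (rule nn_integral_cong)
    fix x
    have "V (dilate d h) x = ennreal (d powr (n / q) * v (d *\<^sub>R x))"
      using v(2)[of "d *\<^sub>R x"] by (simp add: V_dilate[OF h d] v(3) ennreal_mult less_imp_le)
    moreover have "0 < d powr (n / q) * v (d *\<^sub>R x)"
      using d v(2) by simp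
    ultimately show "ennpowr (V (dilate d h) x) q = ennreal (d powr n) * ennreal (v (d *\<^sub>R x) powr q)"
      using d v(2)[of "d *\<^sub>R x"] q
      by (simp add: ennpowr_ennreal less_imp_le ennreal_mult[symmetric] powr_mult powr_powr)
  qed
  also have "\<dots> = ennreal (d powr n) * (ennreal (d powr (-n)) * A (V h))"
    using nn_integral_dilate[OF m d] m' by (simp add: nn_integral_cmult AV)
  also have "\<dots> = A (V h)"
    using d by (simp add: mult.assoc[symmetric] ennreal_mult[symmetric] powr_add[symmetric])
  finally show ?thesis .
qed

text \<open>One number \<open>m\<close> plays two roles: it is the minimum of the potential,
  attained at \<open>x0\<close>, and it takes the place of the mass in \<open>regular\<close>.
  \<open>v\<close> is the real-valued version of \<open>V h\<close>.\<close>

definition normalized :: "('a \<Rightarrow> real) \<Rightarrow> ('a \<Rightarrow> real) \<Rightarrow> 'a \<Rightarrow> real \<Rightarrow> bool" where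
  "normalized h v x0 m \<longleftrightarrow> h \<in> nonneg_meas \<and> N h = 1 \<and> (\<forall>x. V h x = ennreal (v x)) \<and>
     regular m v \<and> 0 < m \<and> v x0 = m \<and> (\<forall>x. m \<le> v x)"

lemma normalized_exists:
  assumes h: "h \<in> nonneg_meas" and Nh: "N h = 1" and A: "A (V h) \<noteq> 0"
  obtains h' v x0 m where "normalized h' v x0 m" "A (V h') = A (V h)"
proof -
  define v where "v x = enn2real (V h x)" for x
  define M where "M = enn2real (mass h)"
  have v: "V h x = ennreal (v x)" "0 \<le> v x" for x
    using V_finite(2)[OF h A, of x] by (auto simp: v_def)
  have M: "mass h = ennreal M" "0 \<le> M"
    using V_finite(1)[OF h A] by (auto simp: M_def)
  have reg: "regular M v"
    using h M v by (intro regular_V)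
  have vpos: "0 < v x" for x
    using N_eq_0[OF h, of x] Nh v[of x] by (cases "v x = 0") (auto simp: less_le)
  have Mpos: "0 < M"
    using N_eq_0[OF h, of 0] Nh M by (cases "M = 0") (auto simp: less_le)
  obtain x0 where x0: "\<And>x. v x0 \<le> v x"
    using regular_attains_inf[OF reg Mpos] by blast
  \<comment> \<open>After dilation the minimum is \<open>d powr (n / q) * v x0\<close> and the mass
    is \<open>d powr (n / q) * (d powr l * M)\<close>; this d equates them.\<close>
  define d where "d = (v x0 / M) powr (1 / l)"
  have d: "0 < d"
    using vpos[of x0] Mpos by (simp add: d_def)
  have dl: "d powr l * M = v x0"
    using vpos[of x0] Mpos l_pos by (simp add: d_def powr_powr)
  let ?h = "dilate d h"
  define w where "w x = d powr (n / q) * v (d *\<^sub>R x)" for x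
  define m where "m = d powr (n / q) * v x0"
  have w: "V ?h x = ennreal (w x)" "0 \<le> w x" "m \<le> w x" for x
    using v[of "d *\<^sub>R x"] x0[of "d *\<^sub>R x"] by (simp_all add: V_dilate[OF h d] ennreal_mult w_def m_def mult_left_mono)
  have "mass ?h = ennreal m"
    using M by (simp add: mass_dilate[OF h d] m_def powr_add mult.assoc dl ennreal_mult[symmetric])
  moreover have "0 < m"
    using d vpos by (simp add: m_def)
  moreover have "?h \<in> nonneg_meas"
    by (rule dilate_nonneg_meas[OF h d])
  ultimately have "regular m w"
    using w by (intro regular_V[of ?h]) auto
  moreover have "w (x0 /\<^sub>R d) = m"
    using d by (simp add: w_def m_def)
  ultimately have "normalized ?h w (x0 /\<^sub>R d) m"
    using w N_dilate[OF h d] Nh \<open>0 < m\<close> \<open>?h \<in> nonneg_meas\<close> by (simp add: normalized_def)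
  moreover have "A (V ?h) = A (V h)"
    using regular_continuous[OF reg] vpos v(1) by (rule A_V_dilate[OF h d])
  ultimately show thesis
    by (rule that)
qed

subsection \<open>Uniform bounds for normalised functions\<close>

text \<open>The shape, up to the factor \<open>m\<close>, that a normalised potential centred at 0
  dominates: 1 is its minimum, and the growth term comes from m |z|^l <= 2^l (v + m) <= 2^(l + 1)
  v.\<close>

definition profile :: "'a \<Rightarrow> real" where
  "profile z = max 1 (2 powr (-(l + 1)) * norm z powr l)"

lemma profile_ge_1: "1 \<le> profile z"
  by (simp add: profile_def)

lemma profile_pos: "0 < profile z"
  using profile_ge_1[of z] by linarith

lemma powr_le_profile: "norm z powr l \<le> 2 powr (l + 1) * profile z"
proof -
  have "2 powr (l + 1) * (2 powr (-(l + 1)) * norm z powr l) \<le> 2 powr (l + 1) * profile z"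
    by (intro mult_left_mono) (auto simp: profile_def)
  then show ?thesis
    by (simp add: mult.assoc[symmetric] powr_add[symmetric])
qed

text \<open>As q < 0, lower bounds on the profile become upper bounds: 1 inside the unit ball, a
  multiple of |z|^(l q) outside, integrable since l q < -n.\<close>

lemma profile_integral_le:
  obtains C where "0 < C"
    "\<And>x0. (\<integral>\<^sup>+ x. ennreal (profile (x - x0) powr q) \<partial>lebesgue) \<le> ennreal C"
proof -
  obtain C3 where C3: "0 \<le> C3" "\<And>r z::'a. 0 < r \<Longrightarrow>
      (\<integral>\<^sup>+ y. ennreal (norm (y - z) powr (-(-(l * q)))) * indicator (- ball z r) y \<partial>lebesgue)
           \<le> ennreal (C3 * r powr (n - (-(l * q))))"
    by (rule nn_integral_radial_outside_ball_le[where 'a='a and a="-(l * q)"])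
      (use lq_less n_eq in auto)
  let ?k = "(2 powr (-(l + 1))) powr q"
  define B where "B = unit_ball_vol (real DIM('a))"
  have B: "0 < B" by (simp add: B_def)
  define C where "C = B + ?k * C3"
  have "(\<integral>\<^sup>+ x. ennreal (profile (x - x0) powr q) \<partial>lebesgue) \<le> ennreal C" for x0 :: 'a
  proof -
    let ?f = "\<lambda>x. ennreal (norm (x - x0) powr (l * q)) * indicator (- ball x0 1) x"
    have m: "?f \<in> borel_measurable lebesgue" "(indicator (ball x0 1) :: 'a \<Rightarrow> ennreal) \<in> borel_measurable lebesgue"
      by (intro borel_measurable_times_ennreal measurable_compose[OF _ measurable_ennreal]
          measurable_norm_powr borel_measurable_indicator; simp add: Compl_in_sets_lebesgue)+
    have "ennreal (profile (x - x0) powr q) \<le> indicator (ball x0 1) x + ennreal ?k * ?f x" for x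
    proof (cases "x \<in> ball x0 1")
      case True
      have "profile (x - x0) powr q \<le> 1 powr q"
        using profile_ge_1 q by (intro powr_mono2') auto
      then show ?thesis
        using True by (simp add: ennreal_le_1)
    next
      case False
      then have "0 < norm (x - x0)"
        by (auto simp: dist_norm)
      then have "profile (x - x0) powr q \<le> (2 powr (-(l + 1)) * norm (x - x0) powr l) powr q"
        using q by (intro powr_mono2') (auto simp: profile_def)
      also have "\<dots> = ?k * norm (x - x0) powr (l * q)"
        by (simp add: powr_mult powr_powr)
      finally show ?thesis
        using False by (simp add: ennreal_mult[symmetric] ennreal_leI)
    qed
    then have "(\<integral>\<^sup>+ x. ennreal (profile (x - x0) powr q) \<partial>lebesgue)
        \<le> (\<integral>\<^sup>+ x. indicator (ball x0 1) x + ennreal ?k * ?f x \<partial>lebesgue)"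
      by (intro nn_integral_mono)
    also have "\<dots> = emeasure lebesgue (ball x0 1) + ennreal ?k * integral\<^sup>N lebesgue ?f"
      using m by (simp add: nn_integral_add nn_integral_cmult)
    also have "\<dots> \<le> ennreal B + ennreal ?k * ennreal C3"
      using C3(2)[of 1 x0] by (intro add_mono mult_left_mono) (auto simp: emeasure_ball B_def)
    also have "\<dots> = ennreal C"
      using B C3(1) by (simp add: C_def ennreal_mult)
    finally show ?thesis .
  qed
  moreover have "0 < C"
    using B C3(1) by (simp add: C_def add_pos_nonneg)
  ultimately show thesis
    using that by blast
qed

lemma normalizedD:
  assumes "normalized h v x0 m"
  shows "h \<in> nonneg_meas" "N h = 1" "V h x = ennreal (v x)" "regular m v" "0 < m" "v x0 = m" "m \<le> v x"
  using assms unfolding normalized_def by auto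

lemma normalized_ge_profile:
  assumes "normalized h v x0 m"
  shows "m * profile (x - x0) \<le> v x"
proof -
  note D = normalizedD[OF assms]
  have "norm (x - x0) powr l * m \<le> 2 powr l * (v x + v x0)"
    by (rule regularD(4)[OF D(4)])
  also have "\<dots> \<le> 2 powr l * (2 * v x)"
    using D(6) D(7)[of x] by simp
  finally have "2 powr (-(l + 1)) * (norm (x - x0) powr l * m) \<le> 2 powr (-(l + 1)) * (2 powr l * (2 * v x))"
    by (rule mult_left_mono) simp
  also have "\<dots> = (2 powr (-(l + 1)) * (2 powr l * 2 powr 1)) * v x"
    by simp
  also have "2 powr (-(l + 1)) * (2 powr l * 2 powr 1) = (1::real)"
    by (simp only: powr_add[symmetric]) simp
  finally show ?thesis
    using D(5) D(7)[of x] by (simp add: profile_def max_mult_distrib_left mult_ac)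
qed

lemma A_ennreal:
  assumes "\<And>x. 0 < F x"
  shows "A (\<lambda>x. ennreal (F x)) = (\<integral>\<^sup>+ x. ennreal (F x powr q) \<partial>lebesgue)"
  unfolding A_def using assms by (simp add: ennpowr_ennreal less_imp_le)

text \<open>For q < 0 the factor \<open>m powr q\<close> decreases in \<open>m\<close>, so a lower
  bound on \<open>A (V h)\<close> caps \<open>m\<close>.\<close>

lemma normalized_A_le:
  obtains C where "0 < C" "\<And>h v x0 m. normalized h v x0 m \<Longrightarrow> A (V h) \<le> ennreal (m powr q * C)"
proof -
  obtain C where C: "0 < C"
    "\<And>x0. (\<integral>\<^sup>+ x. ennreal (profile (x - x0) powr q) \<partial>lebesgue) \<le> ennreal C"
    using profile_integral_le by blast
  have "A (V h) \<le> ennreal (m powr q * C)" if nm: "normalized h v x0 m" for h v x0 m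
  proof -
    note D = normalizedD[OF nm]
    have "V h = (\<lambda>x. ennreal (v x))"
      using D(3) by auto
    then have "A (V h) = (\<integral>\<^sup>+ x. ennreal (v x powr q) \<partial>lebesgue)"
      using D(5,7) by (simp add: A_ennreal less_le_trans)
    also have "\<dots> \<le> (\<integral>\<^sup>+ x. ennreal (m powr q) * ennreal (profile (x - x0) powr q) \<partial>lebesgue)"
    proof (rule nn_integral_mono)
      fix x
      have "v x powr q \<le> (m * profile (x - x0)) powr q"
        using normalized_ge_profile[OF nm] D(5) profile_pos q by (intro powr_mono2') auto
      then show "ennreal (v x powr q) \<le> ennreal (m powr q) * ennreal (profile (x - x0) powr q)"
        using D(5) profile_pos by (simp add: ennreal_mult[symmetric] powr_mult ennreal_leI less_imp_le)
    qed
    also have "\<dots> = ennreal (m powr q) * (\<integral>\<^sup>+ x. ennreal (profile (x - x0) powr q) \<partial>lebesgue)"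
    proof -
      have "(\<lambda>x. ennreal (profile (x - x0) powr q)) \<in> borel_measurable lebesgue"
        unfolding profile_def by (rule measurable_completion) simp
      then show ?thesis by (rule nn_integral_cmult)
    qed
    also have "\<dots> \<le> ennreal (m powr q) * ennreal C"
      by (intro mult_left_mono C) simp
    finally show ?thesis
      using C(1) by (simp add: ennreal_mult)
  qed
  with C(1) show thesis
    using that by blast
qed

text \<open>At the centre the potential is only \<open>m\<close>, so the weight integral has to
  carry a fixed part of N h = 1; but that integral decays as the centre moves away.\<close>

lemma normalized_centre_bounded:
  obtains R where "0 \<le> R" "\<And>h v x0 m. normalized h v x0 m \<Longrightarrow> m \<le> M1 \<Longrightarrow> norm x0 \<le> R"
proof -
  obtain C where C: "0 \<le> C"
    "\<And>z::'a. z \<noteq> 0 \<Longrightarrow> (\<integral>\<^sup>+ y. ennreal ((norm (z - y) powr l * norm y powr b) powr (-s)) \<partial>lebesgue)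
        \<le> ennreal (C * norm z powr (n - (l + b) * s))"
    using weight_integral_le by blast
  define M where "M = max 1 M1"
  define g where "g = (l + b) * s - n"
  have g: "0 < g" using lbs_gt by (simp add: g_def)
  \<comment> \<open>Chosen so that the potential term of the Young inequality is at most 1/2; the
    weight term is then at least 1/2.\<close>
  define t where "t = (1 / (2 * p * M)) powr (1 / (p - 1))"
  have M: "0 < M" "M1 \<le> M" by (auto simp: M_def)
  have t: "0 < t" "t powr (p - 1) = 1 / (2 * p * M)"
    using p M by (auto simp: t_def powr_powr)
  define Q where "Q = 2 * ((1 - p) * t powr p) * C"
  have Q: "0 \<le> Q" using p C by (simp add: Q_def)
  have bound: "norm x0 \<le> Q powr (1 / g)" if nm: "normalized h v x0 m" and m: "m \<le> M1" for h v x0 m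
  proof (cases "x0 = 0")
    case False
    note D = normalizedD[OF nm]
    have "N h \<le> ennreal (p * t powr (p - 1)) * V h x0 + ennreal ((1 - p) * t powr p) * ennreal (C * norm x0 powr (-g))"
      using C(2)[OF False] by (intro order_trans[OF N_le_Young[OF D(1) t(1)]] add_mono mult_left_mono)
        (auto simp: g_def)
    then have "1 \<le> p * t powr (p - 1) * m + (1 - p) * t powr p * (C * norm x0 powr (-g))"
      using D(2) D(3)[of x0] D(5,6) p C(1)
      by (simp add: ennreal_mult[symmetric] ennreal_plus[symmetric] del: ennreal_plus)
    also have "p * t powr (p - 1) * m = m / M / 2"
      using p M by (simp add: t(2))
    also have "\<dots> \<le> 1 / 2"
      using m M by simp
    also have "(1 - p) * t powr p * (C * norm x0 powr (-g)) = Q * norm x0 powr (-g) / 2"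
      by (simp add: Q_def)
    finally have "1 \<le> Q * norm x0 powr (-g)"
      by simp
    then have "norm x0 powr g \<le> Q"
      using False by (simp add: powr_minus field_simps)
    then have "(norm x0 powr g) powr (1 / g) \<le> Q powr (1 / g)"
      using g by (intro powr_mono2) auto
    then show ?thesis
      using g False by (simp add: powr_powr)
  qed simp
  show thesis
    by (rule that[OF powr_ge_zero bound])
qed

lemma unit_vector_exists: obtains e :: 'a where "norm e = 1"
  using norm_Basis[OF SOME_Basis] by blast

text \<open>The opposite choice of t: the weight term is at most 1/2, so the potential term is at
  least 1/2. A unit vector replaces the centre, which may be near 0, where the bound on the weight
  integral blows up.\<close>

lemma nonneg_meas_V_unit_ge:
  obtains c where "0 < c" "\<And>h e. h \<in> nonneg_meas \<Longrightarrow> N h = 1 \<Longrightarrow> norm e = 1 \<Longrightarrow> ennreal c \<le> V h e"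
proof -
  obtain C where C: "0 \<le> C"
    "\<And>z::'a. z \<noteq> 0 \<Longrightarrow> (\<integral>\<^sup>+ y. ennreal ((norm (z - y) powr l * norm y powr b) powr (-s)) \<partial>lebesgue)
        \<le> ennreal (C * norm z powr (n - (l + b) * s))"
    using weight_integral_le by blast
  define K where "K = max 1 C"
  have K: "0 < K" "C \<le> K" by (auto simp: K_def)
  define t where "t = (1 / (2 * (1 - p) * K)) powr (1 / p)"
  have t: "0 < t" "t powr p = 1 / (2 * (1 - p) * K)"
    using p K by (auto simp: t_def powr_powr)
  define c where "c = 1 / (2 * (p * t powr (p - 1)))"
  have c: "0 < c" using p t by (simp add: c_def)
  have "ennreal c \<le> V h e" if h: "h \<in> nonneg_meas" and Nh: "N h = 1" and e: "norm e = 1" for h e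
  proof (cases "V h e")
    case (real w)
    have "e \<noteq> 0" using e by auto
    then have "N h \<le> ennreal (p * t powr (p - 1)) * V h e + ennreal ((1 - p) * t powr p) * ennreal C"
      using C(2)[of e] e by (intro order_trans[OF N_le_Young[OF h t(1)]] add_mono mult_left_mono) auto
    then have "1 \<le> p * t powr (p - 1) * w + (1 - p) * t powr p * C"
      using Nh real p C(1)
      by (simp add: ennreal_mult[symmetric] ennreal_plus[symmetric] del: ennreal_plus)
    moreover have "(1 - p) * t powr p * C \<le> 1 / 2"
    proof -
      have "(1 - p) * t powr p * C = C / K * (1 / 2)"
        unfolding t(2) using p K by (simp add: divide_simps)
      also have "\<dots> \<le> 1 * (1 / 2)"
        using K by (intro mult_right_mono) auto
      finally show ?thesis by simp
    qed
    ultimately have "1 / 2 \<le> p * t powr (p - 1) * w"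
      by linarith
    then have "c \<le> w"
      using p t(1) by (simp add: c_def field_simps)
    then show ?thesis
      using real by simp
  qed simp
  with c show thesis
    using that by blast
qed

text \<open>The bounds depend on each other: \<open>a0\<close> caps \<open>m\<close>, the cap
  confines the centre to a ball of radius \<open>R\<close>, and \<open>R\<close> converts the lower
  bound at a unit vector into one for \<open>m\<close>.\<close>

lemma normalized_uniform_bounds:
  assumes a0: "0 < a0"
  obtains c C M1 where "0 < c" "0 \<le> C"
    "\<And>h v x0 m. normalized h v x0 m \<Longrightarrow> ennreal a0 \<le> A (V h) \<Longrightarrow> m \<le> M1"
    "\<And>h v x0 m x. normalized h v x0 m \<Longrightarrow> ennreal a0 \<le> A (V h) \<Longrightarrow>
        c * (1 + norm x) powr l \<le> v x \<and> v x \<le> C * (1 + norm x) powr l"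
proof -
  obtain CA where CA: "0 < CA" "\<And>h v x0 m. normalized h v x0 m \<Longrightarrow> A (V h) \<le> ennreal (m powr q * CA)"
    using normalized_A_le by blast
  define M1 where "M1 = (a0 / CA) powr (1 / q)"
  have M1: "m \<le> M1" if nm: "normalized h v x0 m" and a: "ennreal a0 \<le> A (V h)" for h v x0 m
  proof -
    have m: "0 < m" by (rule normalizedD(5)[OF nm])
    have "a0 \<le> m powr q * CA"
      using order_trans[OF a CA(2)[OF nm]] CA(1) by simp
    then have "a0 / CA \<le> m powr q"
      using CA(1) by (simp add: field_simps)
    then have "(m powr q) powr (1 / q) \<le> M1"
      unfolding M1_def using a0 CA(1) q by (intro powr_mono2') auto
    then show ?thesis
      using m q by (simp add: powr_powr)
  qed
  obtain R where R: "0 \<le> R" "\<And>h v x0 m. normalized h v x0 m \<Longrightarrow> m \<le> M1 \<Longrightarrow> norm x0 \<le> R"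
    using normalized_centre_bounded by blast
  obtain e :: 'a where e: "norm e = 1" by (rule unit_vector_exists)
  obtain k where k: "0 < k" "\<And>h e. h \<in> nonneg_meas \<Longrightarrow> N h = 1 \<Longrightarrow> norm e = 1 \<Longrightarrow> ennreal k \<le> V h e"
    using nonneg_meas_V_unit_ge by blast
  \<comment> \<open>An upper bound for v / m on the unit sphere when |x0| <= R; hence k <= v e <= m
    S, and m >= k / S.\<close>
  define S where "S = 2 powr l * (1 + (1 + R) powr l)"
  have S: "0 < S" by (simp add: S_def add_pos_nonneg)
  have upper: "v x \<le> m * S * (1 + norm x) powr l" and
    lower: "k / S / (2 powr l * (S + 2 powr (l + 1))) * (1 + norm x) powr l \<le> v x"
    if nm: "normalized h v x0 m" and a: "ennreal a0 \<le> A (V h)" for h v x0 m x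
  proof -
    note D = normalizedD[OF nm]
    have x0: "norm x0 \<le> R" using R(2)[OF nm M1[OF nm a]] .
    have up: "v x \<le> m * (2 powr l * (1 + (norm x + R) powr l))" for x
    proof -
      have "norm (x - x0) powr l \<le> (norm x + R) powr l"
        using l_pos x0 norm_triangle_ineq4[of x x0] by (intro powr_mono2) auto
      then have "m * (2 powr l * (1 + norm (x - x0) powr l)) \<le> m * (2 powr l * (1 + (norm x + R) powr l))"
        using D(5) by (intro mult_left_mono) auto
      then show ?thesis
        using regular_le[OF D(4), of x x0] D(6) by (simp add: algebra_simps)
    qed
    have "1 + (norm x + R) powr l \<le> (1 + norm x) powr l + ((1 + R) * (1 + norm x)) powr l"
      using l_pos R(1) by (intro add_mono powr_mono2 ge_one_powr_ge_zero) (auto simp: algebra_simps)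
    also have "\<dots> = (1 + (1 + R) powr l) * (1 + norm x) powr l"
      by (subst powr_mult) (simp add: distrib_right)
    finally have "m * (2 powr l * (1 + (norm x + R) powr l)) \<le> m * (2 powr l * ((1 + (1 + R) powr l) * (1 + norm x) powr l))"
      using D(5) by (intro mult_left_mono) auto
    with up[of x] show "v x \<le> m * S * (1 + norm x) powr l"
      by (simp add: S_def mult.assoc)
    have "k \<le> v e"
      using k(2)[OF D(1,2) e] D(3)[of e] order_trans[OF less_imp_le[OF D(5)] D(7)[of e]] by simp
    also have "\<dots> \<le> m * S"
      using up[of e] e by (simp add: S_def)
    finally have m: "k / S \<le> m"
      using S by (simp add: field_simps)
    \<comment> \<open>For the lower bound the growth is recentred at \<open>x0\<close>; the constant
      (1 + R)^l is at most S and is absorbed because the profile is at least 1.\<close>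
    have "(1 + norm x) powr l \<le> ((1 + R) + norm (x - x0)) powr l"
      using l_pos x0 norm_triangle_sub[of x x0] by (intro powr_mono2) auto
    also have "\<dots> \<le> 2 powr l * ((1 + R) powr l + norm (x - x0) powr l)"
      using powr_add_le_weighted[of "1 + R" "norm (x - x0)" 1 l] R(1) l_pos by (simp add: distrib_left)
    also have "\<dots> \<le> 2 powr l * (S * profile (x - x0) + 2 powr (l + 1) * profile (x - x0))"
    proof -
      have "(1 + R) powr l \<le> 1 * (1 + (1 + R) powr l)"
        by simp
      also have "\<dots> \<le> S"
        unfolding S_def using l_pos by (intro mult_right_mono ge_one_powr_ge_zero) auto
      also have "\<dots> \<le> S * profile (x - x0)"
        using S profile_ge_1[of "x - x0"] by simp
      finally show ?thesis
        using powr_le_profile[of "x - x0"] by (intro mult_left_mono add_mono) auto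
    qed
    finally have "(1 + norm x) powr l \<le> (2 powr l * (S + 2 powr (l + 1))) * profile (x - x0)"
      by (simp add: algebra_simps)
    then have "(1 + norm x) powr l / (2 powr l * (S + 2 powr (l + 1))) \<le> profile (x - x0)"
      using S by (simp add: pos_divide_le_eq add_pos_nonneg mult.commute)
    then have "k / S * ((1 + norm x) powr l / (2 powr l * (S + 2 powr (l + 1)))) \<le> m * profile (x - x0)"
      using m k(1) S D(5) by (intro mult_mono) (auto intro!: divide_nonneg_nonneg add_nonneg_nonneg)
    also have "\<dots> \<le> v x"
      by (rule normalized_ge_profile[OF nm])
    finally show "k / S / (2 powr l * (S + 2 powr (l + 1))) * (1 + norm x) powr l \<le> v x"
      by simp
  qed
  show thesis
  proof (rule that)
    show "0 < k / S / (2 powr l * (S + 2 powr (l + 1)))"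
      using k(1) S by (simp add: add_pos_pos)
    show "0 \<le> M1 * S"
      using S by (simp add: M1_def)
    show "m \<le> M1" if "normalized h v x0 m" "ennreal a0 \<le> A (V h)" for h v x0 m
      using M1 that by blast
    show "k / S / (2 powr l * (S + 2 powr (l + 1))) * (1 + norm x) powr l \<le> v x \<and> v x \<le> M1 * S * (1 + norm x) powr l"
      if nm: "normalized h v x0 m" and a: "ennreal a0 \<le> A (V h)" for h v x0 m x
    proof
      show "k / S / (2 powr l * (S + 2 powr (l + 1))) * (1 + norm x) powr l \<le> v x"
        by (rule lower[OF nm a])
      have "m * S * (1 + norm x) powr l \<le> M1 * S * (1 + norm x) powr l"
        using S M1[OF nm a] by (intro mult_right_mono) auto
      with upper[OF nm a, of x] show "v x \<le> M1 * S * (1 + norm x) powr l"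
        by linarith
    qed
  qed
qed

subsection \<open>Convergence of near-maximisers\<close>

lemma N_integral:
  assumes g: "g \<in> nonneg_meas" and B: "N g \<le> ennreal B"
  shows "integrable lebesgue (\<lambda>x. g x powr p)" "N g = ennreal (LINT x|lebesgue. g x powr p)"
proof -
  show 1: "integrable lebesgue (\<lambda>x. g x powr p)"
    using nonneg_measD(1)[OF g] le_less_trans[OF B ennreal_less_top]
    by (intro integrableI_nonneg) (auto simp: N_def)
  show "N g = ennreal (LINT x|lebesgue. g x powr p)"
    unfolding N_def using 1 by (intro nn_integral_eq_integral) auto
qed

text \<open>
  Near-maximisers of a strictly concave functional converge: the midpoint of two of them is again
  admissible, so the midpoint defect, which controls their distance, has to be small.
\<close>

lemma maximizing_sequence_converges:
  assumes X: "\<And>k. X k \<subseteq> nonneg_meas" and dec: "\<And>i j. i \<le> j \<Longrightarrow> X j \<subseteq> X i"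
    and mid: "\<And>k f g. f \<in> X k \<Longrightarrow> g \<in> X k \<Longrightarrow> (\<lambda>x. (f x + g x) / 2) \<in> X k"
    and ne: "\<And>k. \<exists>g\<in>X k. 1 \<le> N g"
    and B: "\<And>g. g \<in> X 0 \<Longrightarrow> N g \<le> ennreal B" and B0: "0 \<le> B"
  obtains g h where "\<And>j. g j \<in> X j" "h \<in> nonneg_meas" "AE x in lebesgue. (\<lambda>j. g j x) \<longlonglongrightarrow> h x" "1 \<le> N h"
proof -
  define J where "J g = (LINT x|lebesgue. g x powr p)" for g :: "'a \<Rightarrow> real"
  have TB: "g \<in> nonneg_meas" "N g \<le> ennreal B" "integrable lebesgue (\<lambda>x. g x powr p)" "N g = ennreal (J g)"
    "0 \<le> J g" "J g \<le> B" if "g \<in> X k" for g k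
  proof -
    show g: "g \<in> nonneg_meas" "N g \<le> ennreal B"
      using X B that dec[of 0 k] by auto
    show "integrable lebesgue (\<lambda>x. g x powr p)" and N: "N g = ennreal (J g)"
      using N_integral[OF g] by (auto simp: J_def)
    show "0 \<le> J g"
      unfolding J_def by (intro integral_nonneg_AE) auto
    show "J g \<le> B"
      using g(2) N B0 by simp
  qed
  define S where "S k = Sup (J ` X k)" for k
  have bdd: "bdd_above (J ` X k)" for k
    using TB(6) by (intro bdd_aboveI[of _ B]) auto
  have nonempty: "X k \<noteq> {}" for k
    using ne by blast
  have le_S: "J g \<le> S k" if "g \<in> X k" for g k
    unfolding S_def using that bdd by (intro cSup_upper) auto
  have S_ge: "1 \<le> S k" for k
  proof -
    obtain g where g: "g \<in> X k" "1 \<le> N g"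
      using ne by blast
    then have "1 \<le> J g"
      using TB(4,5)[OF g(1)] by simp
    then show ?thesis
      using le_S[OF g(1)] by simp
  qed
  have S_dec: "S j \<le> S i" if "i \<le> j" for i j
    unfolding S_def using dec[OF that] bdd nonempty by (intro cSup_subset_mono) auto
  have "\<exists>g\<in>X k. S k - 1 / real (k + 1) < J g" for k :: nat
  proof -
    have "S k - 1 / real (k + 1) < S k"
      by simp
    then show ?thesis
      unfolding S_def using bdd nonempty by (subst (asm) less_cSup_iff) auto
  qed
  then obtain g where g: "\<And>k. g k \<in> X k" "\<And>k::nat. S k - 1 / real (k + 1) < J (g k)"
    by metis
  have "convergent S"
  proof (rule Bseq_monoseq_convergent)
    show "Bseq S"
    proof (rule BseqI')
      show "norm (S k) \<le> S 0" for k
        using S_ge[of k] S_dec[of 0 k] by simp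
    qed
    show "monoseq S"
      using S_dec by (auto simp: monoseq_def)
  qed
  then have CS: "Cauchy S"
    by (rule convergent_Cauchy)
  define u where "u k x = g k x powr p" for k x
  have int_u: "integrable lebesgue (u k)" for k
    using TB(3)[OF g(1)[of k]] by (simp add: u_def[abs_def])
  \<comment> \<open>For i <= j both functions lie in \<open>X i\<close>, and so does their midpoint,
    whose value is at most \<open>S i\<close>. Since the two values exceed S i - 1/(i + 1) and S j -
    1/(j + 1), the integrated defect is at most (S i - S j) / 2 + 1/(i + 1).\<close>
  have diff: "(LINT x|lebesgue. norm (u i x - u j x)) \<le> e * (2 * B)
        + 18 / (p * (1 - p) * e) * ((S i - S j) / 2 + 1 / real (i + 1))"
    if e: "0 < e" and ij: "i \<le> j" for e and i j :: nat
  proof -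
    have gT: "g i \<in> X i" "g j \<in> X i"
      using g(1) dec[OF ij] by auto
    let ?w = "\<lambda>x. (g i x + g j x) / 2"
    let ?K = "18 / (p * (1 - p) * e)"
    have K: "0 \<le> ?K" using p e by simp
    have w: "?w \<in> X i" by (rule mid[OF gT])
    have int: "integrable lebesgue (\<lambda>x. ?w x powr p)" by (rule TB(3)[OF w])
    have "(LINT x|lebesgue. norm (u i x - u j x))
      \<le> (LINT x|lebesgue. e * (u i x + u j x) + ?K * (?w x powr p - (u i x + u j x) / 2))"
    proof (rule integral_mono)
      show "integrable lebesgue (\<lambda>x. norm (u i x - u j x))"
        using int_u by auto
      show "integrable lebesgue (\<lambda>x. e * (u i x + u j x) + ?K * (?w x powr p - (u i x + u j x) / 2))"
        using int_u int by (intro Bochner_Integration.integrable_add integrable_mult_right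
            Bochner_Integration.integrable_diff integrable_divide)
      show "norm (u i x - u j x) \<le> e * (u i x + u j x) + ?K * (?w x powr p - (u i x + u j x) / 2)" for x
        unfolding u_def real_norm_def
        by (rule abs_powr_diff_le_midpoint_defect[OF p _ _ e]) (rule nonneg_measD(2)[OF TB(1)[OF g(1)]])+
    qed
    also have "\<dots> = e * (J (g i) + J (g j)) + ?K * (J ?w - (J (g i) + J (g j)) / 2)"
      using int_u int by (simp add: J_def u_def[abs_def, symmetric] u_def[symmetric])
    also have "\<dots> \<le> e * (B + B) + ?K * ((S i - S j) / 2 + 1 / real (i + 1))"
    proof (intro add_mono mult_left_mono)
      have "1 / real (j + 1) \<le> 1 / real (i + 1)"
        using ij by (intro divide_left_mono) auto
      then show "J ?w - (J (g i) + J (g j)) / 2 \<le> (S i - S j) / 2 + 1 / real (i + 1)"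
        using le_S[OF w] g(2)[of i] g(2)[of j] by argo
    qed (use TB(6)[OF g(1)] e K in auto)
    finally show ?thesis by simp
  qed
  have cauchy: "\<exists>M. \<forall>i\<ge>M. \<forall>j\<ge>M. (LINT x|lebesgue. norm (u i x - u j x)) < d" if d: "0 < d" for d
  proof -
    \<comment> \<open>Spends less than d / 2 on the first term of \<open>diff\<close>; with e fixed,
      convergence of \<open>S\<close> makes the second term small.\<close>
    define e where "e = d / (4 * (B + 1))"
    have e: "0 < e" using d B0 by (simp add: e_def)
    have eB: "e * (2 * B) < d / 2"
    proof -
      have "e * (2 * B) < e * (2 * (B + 1))"
        using e by simp
      also have "\<dots> = d / 2"
        using B0 by (simp add: e_def field_simps)
      finally show ?thesis .
    qed
    define K where "K = 18 / (p * (1 - p) * e)"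
    have K: "0 < K" using p e by (simp add: K_def)
    have "0 < d / (4 * K)" using d K by simp
    then obtain M1 where M1: "\<And>i j. M1 \<le> i \<Longrightarrow> M1 \<le> j \<Longrightarrow> dist (S i) (S j) < d / (4 * K)"
      using CS unfolding Cauchy_def by meson
    obtain M2 where M2: "1 / real (Suc M2) < d / (4 * K)"
      using nat_approx_posE[OF \<open>0 < d / (4 * K)\<close>] by metis
    define M where "M = max M1 M2"
    have *: "(LINT x|lebesgue. norm (u i x - u j x)) < d" if ij: "M \<le> i" "i \<le> j" for i j
    proof -
      have "1 / real (i + 1) \<le> 1 / real (Suc M2)"
        using ij by (intro divide_left_mono) (auto simp: M_def)
      moreover have "S i - S j < d / (4 * K)"
        using M1[of i j] ij by (auto simp: M_def dist_real_def)
      moreover have "0 < d / (4 * K)" by fact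
      ultimately have "(S i - S j) / 2 + 1 / real (i + 1) < 2 * (d / (4 * K))"
        using M2 by argo
      then have "K * ((S i - S j) / 2 + 1 / real (i + 1)) < d / 2"
        using K by (simp add: field_simps)
      then show ?thesis
        using diff[OF e ij(2)] eB unfolding K_def by linarith
    qed
    have "(LINT x|lebesgue. norm (u i x - u j x)) < d" if "M \<le> i" "M \<le> j" for i j
      using *[of i j] *[of j i] that norm_minus_commute[of "u i _"] by (cases "i \<le> j") auto
    then show ?thesis by blast
  qed
  obtain r where r: "strict_mono r" "AE x in lebesgue. Cauchy (\<lambda>i. u (r i) x)"
    using cauchy_L1_AE_cauchy_subseq[of lebesgue u, OF int_u cauchy] by blast
  define w where "w x = lim (\<lambda>i. u (r i) x)" for x
  have meas_u: "u k \<in> borel_measurable lebesgue" for k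
    using int_u by (rule borel_measurable_integrable)
  have meas_w: "w \<in> borel_measurable lebesgue"
    unfolding w_def[abs_def] by (rule borel_measurable_lim_metric) (rule meas_u)
  have u0: "0 \<le> u k x" for k x by (simp add: u_def)
  have lim_w: "AE x in lebesgue. (\<lambda>i. u (r i) x) \<longlonglongrightarrow> w x"
    using r(2) by eventually_elim (simp add: w_def Cauchy_convergent_iff convergent_LIMSEQ_iff)
  \<comment> \<open>Where the sequence diverges, \<open>lim\<close> is an unspecified real; the
    absolute value keeps h^p = |w| valid everywhere.\<close>
  define h where "h x = \<bar>w x\<bar> powr (1 / p)" for x
  have h: "h \<in> nonneg_meas"
    using meas_w by (simp add: nonneg_meas_def h_def[abs_def])
  have hw: "h x powr p = \<bar>w x\<bar>" for x
    using p by (simp add: h_def powr_powr)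
  have "AE x in lebesgue. (\<lambda>j. g (r j) x) \<longlonglongrightarrow> h x"
    using lim_w
  proof eventually_elim
    case (elim x)
    have "(\<lambda>i. \<bar>u (r i) x\<bar> powr (1 / p)) \<longlonglongrightarrow> \<bar>w x\<bar> powr (1 / p)"
      using p by (intro tendsto_powr2 tendsto_rabs elim tendsto_const) auto
    moreover have "\<bar>u k x\<bar> powr (1 / p) = g k x" for k
      using p nonneg_measD(2)[OF TB(1)[OF g(1)[of k]], of x] by (simp add: u_def powr_powr)
    ultimately show ?case
      by (simp add: h_def)
  qed
  \<comment> \<open>Convergence in L^1 of the p-th powers rules out loss in the limit: N (g k) <= N
    h + e / 2, while N (g k) > S k - 1/(k + 1) >= 1 - e / 2.\<close>
  moreover have "1 \<le> N h"
  proof (rule ennreal_le_epsilon)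
    fix e :: real
    assume e: "0 < e"
    obtain M where M: "\<And>i j. M \<le> i \<Longrightarrow> M \<le> j \<Longrightarrow> (LINT x|lebesgue. norm (u i x - u j x)) < e / 2"
      using cauchy[of "e / 2"] e by auto
    obtain M2 where M2: "1 / real (Suc M2) < e / 2"
      using nat_approx_posE[of "e / 2"] e by (metis half_gt_zero)
    define k where "k = max M M2"
    have "(\<integral>\<^sup>+ x. ennreal \<bar>u k x - w x\<bar> \<partial>lebesgue) \<le> ennreal (e / 2)"
    proof -
      have "(\<integral>\<^sup>+ x. ennreal \<bar>u k x - w x\<bar> \<partial>lebesgue)
          = (\<integral>\<^sup>+ x. liminf (\<lambda>i. ennreal \<bar>u k x - u (r i) x\<bar>) \<partial>lebesgue)"
      proof (rule nn_integral_cong_AE)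
        show "AE x in lebesgue. ennreal \<bar>u k x - w x\<bar> = liminf (\<lambda>i. ennreal \<bar>u k x - u (r i) x\<bar>)"
          using lim_w
        proof eventually_elim
          case (elim x)
          have "(\<lambda>i. ennreal \<bar>u k x - u (r i) x\<bar>) \<longlonglongrightarrow> ennreal \<bar>u k x - w x\<bar>"
            by (intro tendsto_ennrealI tendsto_rabs tendsto_diff tendsto_const elim)
          then show ?case
            by (rule lim_imp_Liminf[OF sequentially_bot, symmetric])
        qed
      qed
      also have "\<dots> \<le> liminf (\<lambda>i. \<integral>\<^sup>+ x. ennreal \<bar>u k x - u (r i) x\<bar> \<partial>lebesgue)"
        using meas_u by (intro nn_integral_liminf) auto
      also have "\<dots> \<le> ennreal (e / 2)"
      proof (rule Liminf_le)
        show "\<forall>\<^sub>F i in sequentially. (\<integral>\<^sup>+ x. ennreal \<bar>u k x - u (r i) x\<bar> \<partial>lebesgue) \<le> ennreal (e / 2)"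
          using eventually_ge_at_top[of M]
        proof eventually_elim
          case (elim i)
          have "M \<le> r i"
            using elim seq_suble[OF r(1), of i] by simp
          then have "(LINT x|lebesgue. norm (u k x - u (r i) x)) \<le> e / 2"
            using M[of k "r i"] by (simp add: k_def)
          moreover have "(\<integral>\<^sup>+ x. ennreal \<bar>u k x - u (r i) x\<bar> \<partial>lebesgue)
              = ennreal (LINT x|lebesgue. norm (u k x - u (r i) x))"
            using int_u by (subst nn_integral_eq_integral) auto
          ultimately show ?case
            by (simp add: ennreal_leI)
        qed
      qed simp
      finally show ?thesis .
    qed
    then have 1: "N (g k) \<le> N h + ennreal (e / 2)"
    proof -
      have "N (g k) \<le> (\<integral>\<^sup>+ x. ennreal (h x powr p) + ennreal \<bar>u k x - w x\<bar> \<partial>lebesgue)"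
        unfolding N_def
        by (intro nn_integral_mono) (auto simp: hw u_def ennreal_plus[symmetric] simp del: ennreal_plus intro!: ennreal_leI)
      also have "\<dots> = N h + (\<integral>\<^sup>+ x. ennreal \<bar>u k x - w x\<bar> \<partial>lebesgue)"
        unfolding N_def using nonneg_measD(1)[OF h] meas_u meas_w by (intro nn_integral_add) auto
      also have "\<dots> \<le> N h + ennreal (e / 2)"
        by (intro add_left_mono) fact
      finally show ?thesis .
    qed
    have "1 - e / 2 \<le> J (g k)"
    proof -
      have "1 / real (k + 1) \<le> 1 / real (Suc M2)"
        by (intro divide_left_mono) (auto simp: k_def)
      then show ?thesis
        using g(2)[of k] S_ge[of k] M2 by linarith
    qed
    then have "1 \<le> N (g k) + ennreal (e / 2)"
      using TB(4,5)[OF g(1)[of k]] e by (simp add: ennreal_plus[symmetric] del: ennreal_plus)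
    also have "\<dots> \<le> (N h + ennreal (e / 2)) + ennreal (e / 2)"
      by (intro add_right_mono 1)
    also have "\<dots> = N h + ennreal e"
      using e by (simp add: add.assoc ennreal_plus[symmetric] del: ennreal_plus)
    finally show "1 \<le> N h + ennreal e" .
  qed
  moreover have "g (r j) \<in> X j" for j
    using g(1)[of "r j"] dec[OF seq_suble[OF r(1), of j]] by auto
  ultimately show thesis
    using h that[of "\<lambda>j. g (r j)" h] by blast
qed

subsection \<open>Existence of a maximiser\<close>

definition A_sup :: ennreal where
  "A_sup = (SUP h\<in>{h\<in>nonneg_meas. N h = 1}. A (V h))"

lemma maximizing_normalized_sequence:
  assumes "A_sup \<noteq> 0" "{h\<in>nonneg_meas. N h = 1} \<noteq> {}"
  obtains hs vs xs ms a where "0 < a" "\<And>k. normalized (hs k) (vs k) (xs k) (ms k)"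
    "\<And>k::nat. ennreal a \<le> A (V (hs k))" "(\<lambda>k. A (V (hs k))) \<longlonglongrightarrow> A_sup"
proof -
  obtain f :: "nat \<Rightarrow> ennreal" where f: "incseq f" "range f \<subseteq> (\<lambda>h. A (V h)) ` {h\<in>nonneg_meas. N h = 1}" "A_sup = (SUP i. f i)"
    unfolding A_sup_def using ennreal_Sup_countable_SUP[of "(\<lambda>h. A (V h)) ` {h\<in>nonneg_meas. N h = 1}"] assms(2) by blast
  have lim: "f \<longlonglongrightarrow> A_sup"
    unfolding f(3) by (rule LIMSEQ_SUP[OF f(1)])
  \<comment> \<open>At this point \<open>A_sup\<close> may still be infinite, so the uniform bounds
    are based on some positive number below it. Its finiteness follows from dominated
    convergence.\<close>
  obtain c where c: "0 < c" "c < A_sup"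
    using assms(1) dense[of 0 A_sup] by (auto simp: zero_less_iff_neq_zero)
  then obtain a where a: "c = ennreal a" "0 < a"
    by (cases c) auto
  obtain K where K: "\<And>k. K \<le> k \<Longrightarrow> c < f k"
    using order_tendstoD(1)[OF lim c(2)] unfolding eventually_sequentially by blast
  have "\<exists>h v x m. normalized h v x m \<and> A (V h) = f (k + K)" for k
  proof -
    obtain h where h: "h \<in> nonneg_meas" "N h = 1" "A (V h) = f (k + K)"
      using f(2) by (smt (verit) image_iff mem_Collect_eq rangeI subset_iff)
    then have "A (V h) \<noteq> 0"
      using K[of "k + K"] by auto
    then show ?thesis
      using normalized_exists[OF h(1,2)] h(3) by metis
  qed
  then obtain hs vs xs ms where s: "\<And>k. normalized (hs k) (vs k) (xs k) (ms k)" "\<And>k. A (V (hs k)) = f (k + K)"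
    by metis
  have "(\<lambda>k. A (V (hs k))) \<longlonglongrightarrow> A_sup"
    unfolding s(2) by (rule LIMSEQ_ignore_initial_segment[OF lim])
  moreover have "ennreal a \<le> A (V (hs k))" for k
    using K[of "k + K"] a(1) by (simp add: s(2) less_imp_le)
  ultimately show thesis
    using that a(2) s(1) by blast
qed

text \<open>The uniform lower bound on the potentials, raised to the negative power q, is the
  majorant for dominated convergence.\<close>

lemma dominating_integrable:
  assumes c: "0 < c"
  shows "(\<integral>\<^sup>+ x. ennreal ((c * (1 + norm (x::'a)) powr l) powr q) \<partial>lebesgue) < \<infinity>"
proof -
  obtain C where C: "0 < C"
    "\<And>x0. (\<integral>\<^sup>+ x. ennreal (profile (x - x0) powr q) \<partial>lebesgue) \<le> ennreal C"
    using profile_integral_le by blast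
  have "(c * (1 + norm x) powr l) powr q \<le> c powr q * profile x powr q" for x :: 'a
  proof -
    have "2 powr (-(l + 1)) \<le> 2 powr (0::real)"
      using l_pos by (intro powr_mono) auto
    then have "2 powr (-(l + 1)) * norm x powr l \<le> 1 * (1 + norm x) powr l"
      using l_pos by (intro mult_mono powr_mono2) auto
    moreover have "1 \<le> (1 + norm x) powr l"
      using l_pos by (intro ge_one_powr_ge_zero) auto
    ultimately have "profile x \<le> (1 + norm x) powr l"
      by (simp add: profile_def)
    then have "c * profile x \<le> c * (1 + norm x) powr l"
      using c by simp
    then have "(c * (1 + norm x) powr l) powr q \<le> (c * profile x) powr q"
      using c profile_pos[of x] q by (intro powr_mono2') auto
    then show ?thesis
      using c profile_pos[of x] by (simp add: powr_mult)
  qed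
  then have "(\<integral>\<^sup>+ x. ennreal ((c * (1 + norm (x::'a)) powr l) powr q) \<partial>lebesgue)
      \<le> (\<integral>\<^sup>+ x. ennreal (c powr q) * ennreal (profile (x - 0) powr q) \<partial>lebesgue)"
    by (intro nn_integral_mono) (simp add: ennreal_mult[symmetric] ennreal_leI)
  also have "\<dots> = ennreal (c powr q) * (\<integral>\<^sup>+ x. ennreal (profile (x - 0) powr q) \<partial>lebesgue)"
    unfolding profile_def by (intro nn_integral_cmult measurable_completion) simp
  also have "\<dots> \<le> ennreal (c powr q) * ennreal C"
    by (intro mult_left_mono C) simp
  also have "\<dots> < \<infinity>"
    by (simp add: ennreal_mult_less_top)
  finally show ?thesis .
qed

lemma V_average:
  assumes f: "f \<in> nonneg_meas" and g: "g \<in> nonneg_meas"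
  shows "(\<lambda>x. (f x + g x) / 2) \<in> nonneg_meas"
    and "V (\<lambda>x. (f x + g x) / 2) x = ennreal (1/2) * (V f x + V g x)"
proof -
  show "(\<lambda>x. (f x + g x) / 2) \<in> nonneg_meas"
    using nonneg_measD[OF f] nonneg_measD[OF g] by (simp add: nonneg_meas_def)
  have "V (\<lambda>x. (f x + g x) / 2) x = (\<integral>\<^sup>+ y. ennreal (1/2) * (ennreal (norm (x - y) powr l * f y * norm y powr b)
      + ennreal (norm (x - y) powr l * g y * norm y powr b)) \<partial>lebesgue)"
    unfolding V_def
  proof (rule nn_integral_cong)
    fix y
    have eq: "norm (x - y) powr l * ((f y + g y) / 2) * norm y powr b
        = 1/2 * (norm (x - y) powr l * f y * norm y powr b + norm (x - y) powr l * g y * norm y powr b)"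
      by (simp add: algebra_simps)
    have "0 \<le> norm (x - y) powr l * f y * norm y powr b" "0 \<le> norm (x - y) powr l * g y * norm y powr b"
      using nonneg_measD(2)[OF f, of y] nonneg_measD(2)[OF g, of y] by simp_all
    then show "ennreal (norm (x - y) powr l * ((f y + g y) / 2) * norm y powr b)
      = ennreal (1/2) * (ennreal (norm (x - y) powr l * f y * norm y powr b)
        + ennreal (norm (x - y) powr l * g y * norm y powr b))"
      unfolding eq by (subst ennreal_mult') (auto simp: ennreal_plus)
  qed
  also have "\<dots> = ennreal (1/2) * (V f x + V g x)"
    using measurable_integrand(1)[OF f] measurable_integrand(1)[OF g] unfolding V_def
    by (simp add: nn_integral_cmult nn_integral_add)
  finally show "V (\<lambda>x. (f x + g x) / 2) x = ennreal (1/2) * (V f x + V g x)" .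
qed

lemma V_scale:
  assumes h: "h \<in> nonneg_meas" and c: "0 \<le> c"
  shows "V (\<lambda>x. c * h x) x = ennreal c * V h x"
proof -
  have "V (\<lambda>x. c * h x) x = (\<integral>\<^sup>+ y. ennreal c * ennreal (norm (x - y) powr l * h y * norm y powr b) \<partial>lebesgue)"
    unfolding V_def using c by (intro nn_integral_cong) (simp add: ennreal_mult'[symmetric] mult_ac)
  then show ?thesis
    using measurable_integrand(1)[OF h] unfolding V_def by (simp add: nn_integral_cmult)
qed

lemma N_scale:
  assumes h: "h \<in> nonneg_meas" and c: "0 \<le> c"
  shows "N (\<lambda>x. c * h x) = ennreal (c powr p) * N h"
proof -
  have "N (\<lambda>x. c * h x) = (\<integral>\<^sup>+ y. ennreal (c powr p) * ennreal (h y powr p) \<partial>lebesgue)"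
    unfolding N_def using c nonneg_measD(2)[OF h] by (intro nn_integral_cong) (simp add: ennreal_mult powr_mult)
  then show ?thesis
    using nonneg_measD(1)[OF h] unfolding N_def by (simp add: nn_integral_cmult)
qed

lemma V_le_liminf:
  assumes g: "\<And>j. g j \<in> nonneg_meas" and lim: "AE x in lebesgue. (\<lambda>j. g j x) \<longlonglongrightarrow> h x"
  shows "V h x \<le> liminf (\<lambda>j. V (g j) x)"
proof -
  have "V h x = (\<integral>\<^sup>+ y. liminf (\<lambda>j. ennreal (norm (x - y) powr l * g j y * norm y powr b)) \<partial>lebesgue)"
    unfolding V_def
  proof (rule nn_integral_cong_AE)
    show "AE y in lebesgue. ennreal (norm (x - y) powr l * h y * norm y powr b)
        = liminf (\<lambda>j. ennreal (norm (x - y) powr l * g j y * norm y powr b))"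
      using lim
    proof eventually_elim
      case (elim y)
      have "(\<lambda>j. ennreal (norm (x - y) powr l * g j y * norm y powr b))
          \<longlonglongrightarrow> ennreal (norm (x - y) powr l * h y * norm y powr b)"
        by (intro tendsto_ennrealI tendsto_mult tendsto_const elim)
      then show ?case
        by (rule lim_imp_Liminf[OF sequentially_bot, symmetric])
    qed
  qed
  also have "\<dots> \<le> liminf (\<lambda>j. V (g j) x)"
    unfolding V_def using measurable_integrand(1)[OF g] by (intro nn_integral_liminf)
  finally show ?thesis .
qed

lemma A_antimono: "(\<And>x. F x \<le> G x) \<Longrightarrow> A G \<le> A F"
  unfolding A_def using q by (intro nn_integral_mono ennpowr_antimono)

lemma nonneg_meas_N_1_exists: "{h\<in>nonneg_meas. N h = 1} \<noteq> {}"
proof -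
  define c where "c = unit_ball_vol (real DIM('a)) powr (-(1 / p))"
  define h :: "'a \<Rightarrow> real" where "h x = c * indicator (ball 0 1) x" for x
  have B: "0 < unit_ball_vol (real DIM('a))" by simp
  have h: "h \<in> nonneg_meas"
    unfolding nonneg_meas_def h_def[abs_def] mem_Collect_eq
    by (intro conjI allI borel_measurable_times borel_measurable_const borel_measurable_indicator
        mult_nonneg_nonneg) (simp_all add: c_def)
  have "c powr p = unit_ball_vol (real DIM('a)) powr (-1)"
    using p by (simp add: c_def powr_powr)
  then have cp: "c powr p * unit_ball_vol (real DIM('a)) = 1"
    using less_imp_neq[OF B, symmetric] by (simp add: powr_minus)
  have "N h = (\<integral>\<^sup>+ x. ennreal (c powr p) * indicator (ball 0 1) x \<partial>(lebesgue :: 'a measure))"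
    unfolding N_def h_def by (intro nn_integral_cong) (simp split: split_indicator)
  also have "\<dots> = ennreal (c powr p) * emeasure lebesgue (ball (0::'a) 1)"
    by (rule nn_integral_cmult_indicator) simp
  also have "\<dots> = 1"
    using cp B by (simp add: emeasure_ball ennreal_mult[symmetric])
  finally show ?thesis
    using h by blast
qed

lemma A_maximum_attained:
  obtains h where "h \<in> nonneg_meas" "N h = 1" "A (V h) = A_sup"
proof (cases "A_sup = 0")
  \<comment> \<open>The normalisation divides out a dilation only when \<open>A (V h)\<close> is
    nonzero; if the supremum is 0, every admissible function attains it.\<close>
  case True
  obtain h where h: "h \<in> nonneg_meas" "N h = 1"
    using nonneg_meas_N_1_exists by blast
  then have "A (V h) \<le> A_sup"
    unfolding A_sup_def by (intro SUP_upper) auto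
  then show thesis
    using that[OF h] True by simp
next
  case False
  obtain hs vs xs ms a where a: "0 < a" and s: "\<And>k. normalized (hs k) (vs k) (xs k) (ms k)"
    and s_ge: "\<And>k::nat. ennreal a \<le> A (V (hs k))" and s_lim: "(\<lambda>k. A (V (hs k))) \<longlonglongrightarrow> A_sup"
    by (rule maximizing_normalized_sequence[OF False nonneg_meas_N_1_exists]) (rule that)
  obtain c C M1 where c: "0 < c" and C: "0 \<le> C"
    and M1: "\<And>h v x0 m. normalized h v x0 m \<Longrightarrow> ennreal a \<le> A (V h) \<Longrightarrow> m \<le> M1"
    and bounds: "\<And>h v x0 m x. normalized h v x0 m \<Longrightarrow> ennreal a \<le> A (V h) \<Longrightarrow>
        c * (1 + norm x) powr l \<le> v x \<and> v x \<le> C * (1 + norm x) powr l"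
    by (rule normalized_uniform_bounds[OF a]) (rule that)
  have lo: "c * (1 + norm x) powr l \<le> vs k x" and up: "vs k x \<le> C * (1 + norm x) powr l" and msM: "ms k \<le> M1" for k x
    using bounds[OF s s_ge] M1[OF s s_ge] by auto
  have W: "0 < c * (1 + norm x) powr l" for x :: 'a
  proof -
    have "1 + norm x \<noteq> 0"
      using norm_ge_zero[of x] by linarith
    then show ?thesis
      using c by simp
  qed
  have vpos: "0 < vs k x" for k x
    using less_le_trans[OF W lo] .
  have C0: "0 < C * (1 + norm x) powr l" for x :: 'a
    using less_le_trans[OF W order_trans[OF lo up]] .
  have M10: "0 \<le> M1"
    using msM[of 0] normalizedD(5)[OF s[of 0]] by simp
  \<comment> \<open>The radius of equicontinuity may depend on x but not on k: at each x the values
    and the numbers \<open>ms k\<close> have bounds independent of k.\<close>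
  obtain r where r: "strict_mono r" "\<And>x. convergent (\<lambda>k. vs (r k) x)"
  proof (rule pointwise_convergent_subsequence[of "\<lambda>x. C * (1 + norm x) powr l" vs])
    show "\<bar>vs k x\<bar> \<le> C * (1 + norm x) powr l" for k x
      using up[of k x] vpos[of k x] by simp
    show "\<exists>r>0. \<forall>k x'. norm (x - x') < r \<longrightarrow> \<bar>vs k x - vs k x'\<bar> < d" if d: "0 < d" for x d
    proof -
      obtain r where r: "0 < r" "\<And>M F y y'. regular M F \<Longrightarrow> M \<le> M1 \<Longrightarrow> F y \<le> C * (1 + norm x) powr l
          \<Longrightarrow> norm (y - y') < r \<Longrightarrow> \<bar>F y - F y'\<bar> < d"
        by (rule regular_equicontinuous[OF less_imp_le[OF C0] M10 d, of x]) (rule that)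
      then show ?thesis
        using r(1) r(2)[OF normalizedD(4)[OF s] msM up] by (intro exI[of _ r]) blast
    qed
  qed (use C0 in auto)
  define F where "F x = lim (\<lambda>k. vs (r k) x)" for x
  have F: "(\<lambda>k. vs (r k) x) \<longlonglongrightarrow> F x" for x
    using r(2)[of x] by (simp add: F_def convergent_LIMSEQ_iff)
  have F_ge: "c * (1 + norm x) powr l \<le> F x" for x
    using F lo by (intro LIMSEQ_le_const[OF F]) auto
  have F_pos: "0 < F x" for x
    using less_le_trans[OF W F_ge] .
  have V_vs: "V (hs k) = (\<lambda>x. ennreal (vs k x))" for k
    using normalizedD(3)[OF s[of k]] by auto
  have meas_vs: "vs k \<in> borel_measurable lebesgue" for k
    by (rule continuous_imp_lebesgue_measurable[OF regular_continuous[OF normalizedD(4)[OF s[of k]]]])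
  have meas_F: "F \<in> borel_measurable lebesgue"
    using meas_vs F by (rule borel_measurable_LIMSEQ_real[rotated])
  have AF: "A (\<lambda>x. ennreal (F x)) = A_sup"
  proof -
    have "(\<lambda>k. \<integral>\<^sup>+ x. ennreal (vs (r k) x powr q) \<partial>lebesgue) \<longlonglongrightarrow> (\<integral>\<^sup>+ x. ennreal (F x powr q) \<partial>lebesgue)"
    proof (rule nn_integral_dominated_convergence)
      show "(\<lambda>x. ennreal (vs (r k) x powr q)) \<in> borel_measurable lebesgue" for k
        using meas_vs by simp
      show "(\<lambda>x. ennreal (F x powr q)) \<in> borel_measurable lebesgue"
        using meas_F by simp
      show "(\<lambda>x::'a. ennreal ((c * (1 + norm x) powr l) powr q)) \<in> borel_measurable lebesgue"
        by (rule measurable_completion) simp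
      show "AE x in lebesgue. ennreal (vs (r k) x powr q) \<le> ennreal ((c * (1 + norm x) powr l) powr q)" for k
        using W lo q by (intro AE_I2 ennreal_leI powr_mono2') auto
      show "(\<integral>\<^sup>+ x. ennreal ((c * (1 + norm (x::'a)) powr l) powr q) \<partial>lebesgue) < \<infinity>"
        by (rule dominating_integrable[OF c])
      show "AE x in lebesgue. (\<lambda>k. ennreal (vs (r k) x powr q)) \<longlonglongrightarrow> ennreal (F x powr q)"
        using F F_pos by (intro AE_I2 tendsto_ennrealI tendsto_powr tendsto_const) (auto simp: less_imp_neq[symmetric])
    qed
    moreover have "(\<lambda>k. \<integral>\<^sup>+ x. ennreal (vs (r k) x powr q) \<partial>lebesgue) \<longlonglongrightarrow> A_sup"
      using LIMSEQ_subseq_LIMSEQ[OF s_lim r(1)] vpos by (simp add: V_vs A_ennreal o_def)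
    ultimately have "(\<integral>\<^sup>+ x. ennreal (F x powr q) \<partial>lebesgue) = A_sup"
      by (rule LIMSEQ_unique)
    then show ?thesis
      using F_pos by (simp add: A_ennreal)
  qed
  \<comment> \<open>The supremum over the tail guarantees that \<open>hs (r k)\<close> belongs to
    \<open>X k\<close>, so each set has a member with N = 1, while these suprema still decrease to
    F.\<close>
  define X where "X k = {g\<in>nonneg_meas. \<forall>x. V g x \<le> (SUP i\<in>{k..}. ennreal (vs (r i) x))}" for k
  obtain e :: 'a where e: "norm e = 1" by (rule unit_vector_exists)
  obtain K where K: "0 \<le> K" "\<And>z::'a. z \<noteq> 0 \<Longrightarrow>
      (\<integral>\<^sup>+ y. ennreal ((norm (z - y) powr l * norm y powr b) powr (-s)) \<partial>lebesgue)
        \<le> ennreal (K * norm z powr (n - (l + b) * s))"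
    using weight_integral_le by blast
  obtain g h where g: "\<And>j. g j \<in> X j" and h: "h \<in> nonneg_meas"
    and lim: "AE x in lebesgue. (\<lambda>j. g j x) \<longlonglongrightarrow> h x" and Nh: "1 \<le> N h"
  proof (rule maximizing_sequence_converges[of X "p * (C * 2 powr l) + (1 - p) * K"])
    show "X k \<subseteq> nonneg_meas" for k
      by (auto simp: X_def)
    show "X j \<subseteq> X i" if "i \<le> j" for i j
    proof -
      have "(SUP i\<in>{j..}. ennreal (vs (r i) x)) \<le> (SUP i\<in>{i..}. ennreal (vs (r i) x))" for x
        using that by (intro SUP_subset_mono) auto
      then show ?thesis
        unfolding X_def by (blast intro: order_trans)
    qed
    show "(\<lambda>x. (f x + g x) / 2) \<in> X k" if f: "f \<in> X k" and g: "g \<in> X k" for f g k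
    proof -
      have fg: "f \<in> nonneg_meas" "g \<in> nonneg_meas"
        using f g by (auto simp: X_def)
      have "V (\<lambda>x. (f x + g x) / 2) x \<le> (SUP i\<in>{k..}. ennreal (vs (r i) x))" (is "_ \<le> ?S") for x
      proof -
        have "V f x \<le> ?S" "V g x \<le> ?S"
          using f g by (auto simp: X_def)
        then have "V (\<lambda>x. (f x + g x) / 2) x \<le> ennreal (1/2) * (?S + ?S)"
          unfolding V_average(2)[OF fg] by (intro mult_left_mono add_mono) auto
        also have "\<dots> = (ennreal (1/2) + ennreal (1/2)) * ?S"
          by (simp only: distrib_left distrib_right)
        also have "ennreal (1/2) + ennreal (1/2) = 1"
          by (subst ennreal_plus[symmetric]) (simp_all del: ennreal_plus)
        finally show ?thesis by simp
      qed
      then show ?thesis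
        using V_average(1)[OF fg] by (simp add: X_def)
    qed
    show "\<exists>g\<in>X k. 1 \<le> N g" for k
    proof
      show "hs (r k) \<in> X k"
        using normalizedD(1)[OF s] unfolding X_def by (auto simp: V_vs intro!: SUP_upper)
      show "1 \<le> N (hs (r k))"
        using normalizedD(2)[OF s] by simp
    qed
    \<comment> \<open>Young at the unit vector \<open>e\<close> with t = 1; there (1 + |e|)^l = 2^l
      bounds all the potentials.\<close>
    show "N g \<le> ennreal (p * (C * 2 powr l) + (1 - p) * K)" if "g \<in> X 0" for g
    proof -
      have g: "g \<in> nonneg_meas"
        using that by (simp add: X_def)
      have "V g e \<le> (SUP i\<in>{0..}. ennreal (vs (r i) e))"
        using that by (simp add: X_def)
      also have "\<dots> \<le> ennreal (C * 2 powr l)"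
        using up[of _ e] e by (intro SUP_least ennreal_leI) simp
      finally have "V g e \<le> ennreal (C * 2 powr l)" .
      moreover have "e \<noteq> 0" using e by auto
      ultimately have "N g \<le> ennreal (p * 1 powr (p - 1)) * ennreal (C * 2 powr l)
          + ennreal ((1 - p) * 1 powr p) * ennreal K"
        using K(2)[of e] e by (intro order_trans[OF N_le_Young[OF g zero_less_one, of e]] add_mono mult_left_mono) auto
      then show ?thesis
        using p C K(1) by (simp add: ennreal_mult[symmetric] ennreal_plus[symmetric] del: ennreal_plus)
    qed
    show "0 \<le> p * (C * 2 powr l) + (1 - p) * K"
      using p C K(1) by simp
  qed blast
  have g_meas: "g j \<in> nonneg_meas" for j
    using g by (auto simp: X_def)
  have VhF: "V h x \<le> ennreal (F x)" for x
  proof -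
    have "V h x \<le> liminf (\<lambda>j. V (g j) x)"
      by (rule V_le_liminf[OF g_meas lim])
    also have "\<dots> \<le> limsup (\<lambda>j. V (g j) x)"
      by (rule Liminf_le_Limsup) simp
    also have "\<dots> \<le> limsup (\<lambda>i. ennreal (vs (r i) x))"
      unfolding limsup_INF_SUP
    proof (rule INF_mono)
      fix k :: nat
      have "V (g j) x \<le> (SUP i\<in>{k..}. ennreal (vs (r i) x))" if "k \<le> j" for j
      proof -
        have "V (g j) x \<le> (SUP i\<in>{j..}. ennreal (vs (r i) x))"
          using g[of j] by (simp add: X_def)
        also have "\<dots> \<le> (SUP i\<in>{k..}. ennreal (vs (r i) x))"
          using that by (intro SUP_subset_mono) auto
        finally show ?thesis .
      qed
      then show "\<exists>j\<in>UNIV. (SUP i\<in>{j..}. V (g i) x) \<le> (SUP i\<in>{k..}. ennreal (vs (r i) x))"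
        by (intro bexI[of _ k] SUP_least) auto
    qed
    also have "\<dots> = ennreal (F x)"
      using F by (intro lim_imp_Limsup[OF sequentially_bot] tendsto_ennrealI)
    finally show ?thesis .
  qed
  \<comment> \<open>Finiteness of \<open>N h\<close>, required for the rescaling, again comes from
    Young at \<open>e\<close>, now with V h e <= F e.\<close>
  obtain S where S: "N h = ennreal S" "1 \<le> S"
  proof -
    have "e \<noteq> 0" using e by auto
    then have "N h \<le> ennreal (p * 1 powr (p - 1)) * ennreal (F e)
          + ennreal ((1 - p) * 1 powr p) * ennreal K"
      using K(2)[of e] e by (intro order_trans[OF N_le_Young[OF h zero_less_one, of e]] add_mono mult_left_mono VhF) auto
    also have "\<dots> < \<infinity>"
      by (simp add: ennreal_mult_less_top)
    finally show thesis
      using Nh by (intro that[of "enn2real (N h)"]) (auto simp: enn2real_leI intro: ennreal_le_iff[THEN iffD1])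
  qed
  \<comment> \<open>Scaling brings N back to 1; as S >= 1, it only shrinks h, so the potential stays
    below F.\<close>
  define d where "d = S powr (-(1 / p))"
  have d: "0 < d" "d \<le> 1"
    using S(2) p by (auto simp: d_def powr_minus divide_simps ge_one_powr_ge_zero)
  have dp: "d powr p * S = 1"
  proof -
    have "d powr p = S powr (-1)"
      using p by (simp add: d_def powr_powr)
    then show ?thesis
      using S(2) by (simp add: powr_minus)
  qed
  let ?h = "\<lambda>x. d * h x"
  have h': "?h \<in> nonneg_meas"
    using nonneg_measD[OF h] d by (simp add: nonneg_meas_def)
  have N': "N ?h = 1"
    using d S dp by (simp add: N_scale[OF h] ennreal_mult[symmetric])
  have "V ?h x \<le> ennreal (F x)" for x
  proof -
    have "V ?h x = ennreal d * V h x"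
      using d by (intro V_scale[OF h]) simp
    also have "\<dots> \<le> 1 * ennreal (F x)"
      using d by (intro mult_mono VhF) (auto simp: ennreal_le_1)
    finally show ?thesis by simp
  qed
  then have "A_sup \<le> A (V ?h)"
    unfolding AF[symmetric] by (rule A_antimono)
  moreover have "A (V ?h) \<le> A_sup"
    unfolding A_sup_def using h' N' by (intro SUP_upper) auto
  ultimately show thesis
    using that[OF h' N'] by simp
qed

end

theorem theorem1p2:
  fixes p q' q \<alpha> :: real
  assumes "0 < p" and "p < 1"
    and "0 < q'" and "q' < 1"
    and "\<alpha> > real CARD('n::finite)"
    and "1 / p + 1 / q' - 2 * \<alpha> / (q' * real CARD('n)) = 1"
    and "q < 0" and "1 / q + 1 / q' = 1"
  shows "\<exists>h :: real ^ 'n \<Rightarrow> real.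
           h \<in> borel_measurable lebesgue \<and> (\<forall>x. 0 \<le> h x) \<and>
           Lnorm p (\<lambda>x. ennreal (h x)) = 1 \<and>
           Lnorm q (V_op \<alpha> q' h) = C_const TYPE('n) \<alpha> p q' q"
proof -
  define n where "n = real CARD('n)"
  have n: "0 < n" by (simp add: n_def)
  have q': "1 / q' = 1 - 1 / q"
    using assms(8) by simp
  interpret weighted_potential p q "\<alpha> / q'" "\<alpha> / q' - n" n "TYPE(real ^ 'n)"
  proof
    \<comment> \<open>Substituting 1/q' = 1 - 1/q cancels the 1 on both sides and leaves
      \<open>balance\<close>; the same identity turns n - n / q into n / q', so \<alpha> > n becomes
      the last locale assumption.\<close>
    have "n * (1 / p + 1 / q' - 2 * \<alpha> / (q' * n)) = n * 1"
      using assms(6) by (simp add: n_def)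
    then show "n / p - n / q = 2 * (\<alpha> / q')"
      using n by (simp add: q' algebra_simps)
    have "n - n / q = n * (1 / q')"
      by (simp add: q' algebra_simps)
    also have "\<dots> < \<alpha> / q'"
      using assms(3,5) by (simp add: n_def divide_strict_right_mono)
    finally show "n - n / q < \<alpha> / q'" .
  qed (use assms in \<open>auto simp: n_def\<close>)
  have unit: "h \<in> Lp_unit_nonneg p \<longleftrightarrow> h \<in> nonneg_meas \<and> N h = 1" for h :: "real ^ 'n \<Rightarrow> real"
    using assms(1) by (auto simp: Lp_unit_nonneg_def nonneg_meas_def N_def Lnorm_eq_1_iff)
  have V_op: "V_op \<alpha> q' h = V h" for h
    unfolding V_op_def V_def by (rule ext) (simp add: n_def)
  have norm: "Lnorm q F = ennpowr (A F) (1 / q)" for F :: "real ^ 'n \<Rightarrow> ennreal"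
    by (simp add: Lnorm_def A_def)
  obtain h where h: "h \<in> nonneg_meas" "N h = 1" "A (V h) = A_sup"
    by (rule A_maximum_attained)
  \<comment> \<open>The outer power 1/q is negative, hence order-reversing on all of
    [0, \<infinity>] with the stated conventions, so a maximiser of \<open>A\<close> minimises the
    norm.\<close>
  have "Lnorm q (V_op \<alpha> q' h) \<le> Lnorm q (V_op \<alpha> q' g)" if "g \<in> Lp_unit_nonneg p" for g :: "real ^ 'n \<Rightarrow> real"
  proof -
    have "A (V g) \<le> A_sup"
      using that unfolding A_sup_def unit by (intro SUP_upper) auto
    then show ?thesis
      using assms(7) unfolding norm V_op h(3) by (intro ennpowr_antimono) auto
  qed
  then have "Lnorm q (V_op \<alpha> q' h) = C_const TYPE('n) \<alpha> p q' q"
    unfolding C_const_def using h(1,2) unit[of h]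
    by (intro antisym Inf_greatest Inf_lower) auto
  moreover have "h \<in> Lp_unit_nonneg p"
    using h unit by simp
  ultimately show ?thesis
    unfolding Lp_unit_nonneg_def by blast
qed

end
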